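(* Let $\ell\ge 2$ and $0\le i<\ell$. Suppose that $\lambda\approx(\mu,r,\kappa)$ is an $\ell$-partition, and write $\varphi=\varphi_i(\lambda)$, $\varepsilon=\varepsilon_i(\lambda)$. Then 1. If $\varphi>1$, then $\widetilde f_i^{\,\varphi-1}\lambda$ is an $\ell$-partition if and only if: $\kappa_{r+1}=0$, the first row of $\lambda$ has a conormal $i$-box, and $\varphi=r+1$. 2. If $\varepsilon>1$, then $\widetilde e_i\lambda$ is an $\ell$-partition if and only if: the first row of $\lambda$ has a conormal $(i+1)$-box and either ($\varepsilon=r$ and $\kappa_r=0$) or ($\varepsilon=r+1$ and $\kappa_{r+1}=0$).
   Context: A partition is $\ell$-regular if it does not have $\ell$ or more equal nonzero parts. A removable $\ell$-rim hook (for short, $\ell$-rim hook) of $\lambda$ is a connected sequence of $\ell$ boxes of the Young diagram of $\lambda$, containing no $2\times2$ square, whose removal from $\lambda$ leaves the Young diagram of a partition. It is horizontal if all its boxes lie in one row, and non-horizontal otherwise. An $\ell$-core is a partition with no removable $\ell$-rim hook. An $\ell$-partition is an $\ell$-regular partition which has no non-horizontal $\ell$-rim hooks and such that, after removing any number of horizontal $\ell$-rim hooks in any order, the remaining diagram has no non-horizontal $\ell$-rim hooks. Decomposition. Partitions are extended by parts equal to $0$ when needed. Let $\mu$ be an $\ell$-core with $\mu_1-\mu_2\ne\ell-1$, $r\ge0$ an integer, $\kappa=(\kappa_1,\dots,\kappa_{r+1})$ a partition with at most $r+1$ parts. Let $\nu$ be the partition with $\nu_j=\mu_1+(r-j+1)(\ell-1)$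 for $1\le j\le r$ and $\nu_{r+i}=\mu_i$ for $i\ge1$. Then $\lambda\approx(\mu,r,\kappa)$ means $\lambda_i=\nu_i+\ell\kappa_i$ for $1\le i\le r+1$ and $\lambda_i=\nu_i$ for $i>r+1$. (Every $\ell$-partition has a unique such decomposition.) Crystal $B(\Lambda_0)$ of $\widehat{\mathfrak{sl}_\ell}$ (nodes: the $\ell$-regular partitions). The position in row $a$, column $b$ has residue $b-a \bmod \ell$; residues are taken mod $\ell$. A box $x$ of $\lambda$ is a removable $i$-box if it has residue $i$ and $\lambda\setminus x$ is a partition; a position $y\notin\lambda$ is an addable $i$-box if it has residue $i$ and $\lambda\cup y$ is a partition. Put $-$ in each removable $i$-box and $+$ in each addable $i$-box. The $i$-signature of $\lambda$ is the word of $+$'s and $-$'s read from bottom left to top right; the reduced $i$-signature is obtained by repeatedly deleting adjacent pairs $-+$, giving a word $+\cdots+-\cdots-$. Boxes of the remaining $-$'s are the normal $i$-boxes and boxes (positions) of the remaining $+$'s are the conormal $i$-boxes; $\varepsilon_i(\lambda)$ and $\varphi_i(\lambda)$ are their respective numbers. The good $i$-box is the one of the leftmost remaining $-$; the cogood $i$-box is the one of the rightmost remaining $+$. $\widetilde e_i\lambda$ is $\lambda$ with its good $i$-box removed (or $0$ if there is none), and $\widetilde f_i\lambda$ is $\lambda$ with its cogood $i$-box added (or $0$ if there is none). *)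

theory Defs
  imports Main
begin

text \<open>
  Indexing starts at 0 throughout: \<open>p a\<close> is the part with 1-based index \<open>a + 1\<close>, and a box
  is a pair (row, column).  This does not change the residue (column minus row) of a box.
  Partitions are functions, so they are extended by parts equal to 0.
\<close>

type_synonym box = "nat \<times> nat"

definition is_partition :: "(nat \<Rightarrow> nat) \<Rightarrow> bool" where
  "is_partition p \<longleftrightarrow> antimono p \<and> finite {a. p a \<noteq> 0}"

definition num_parts :: "(nat \<Rightarrow> nat) \<Rightarrow> nat" where
  "num_parts p = card {a. p a \<noteq> 0}"

definition diagram :: "(nat \<Rightarrow> nat) \<Rightarrow> box set" where
  "diagram p = {(a, b). b < p a}"

definition is_diagram :: "box set \<Rightarrow> bool" where
  "is_diagram D \<longleftrightarrow> (\<exists>p. is_partition p \<and> diagram p = D)"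

definition regular :: "nat \<Rightarrow> (nat \<Rightarrow> nat) \<Rightarrow> bool" where
  "regular l p \<longleftrightarrow> (\<forall>n>0. card {a. p a = n} < l)"


subsection \<open>Rim hooks, cores and l-partitions\<close>

definition adjacent :: "box \<Rightarrow> box \<Rightarrow> bool" where
  "adjacent x y \<longleftrightarrow>
     (fst x = fst y \<and> (snd y = Suc (snd x) \<or> snd x = Suc (snd y))) \<or>
     (snd x = snd y \<and> (fst y = Suc (fst x) \<or> fst x = Suc (fst y)))"

definition connected_boxes :: "box set \<Rightarrow> bool" where
  "connected_boxes H \<longleftrightarrow>
     (\<forall>x\<in>H. \<forall>y\<in>H. (\<lambda>u v. u \<in> H \<and> v \<in> H \<and> adjacent u v)\<^sup>*\<^sup>* x y)"

definition contains_square :: "box set \<Rightarrow> bool" where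
  "contains_square H \<longleftrightarrow>
     (\<exists>a b. {(a, b), (a, Suc b), (Suc a, b), (Suc a, Suc b)} \<subseteq> H)"

definition rim_hook :: "nat \<Rightarrow> (nat \<Rightarrow> nat) \<Rightarrow> box set \<Rightarrow> bool" where
  "rim_hook l p H \<longleftrightarrow>
     H \<subseteq> diagram p \<and> card H = l \<and> connected_boxes H \<and> \<not> contains_square H \<and>
     is_diagram (diagram p - H)"

definition horizontal :: "box set \<Rightarrow> bool" where
  "horizontal H \<longleftrightarrow> (\<exists>a. \<forall>x\<in>H. fst x = a)"

definition is_core :: "nat \<Rightarrow> (nat \<Rightarrow> nat) \<Rightarrow> bool" where
  "is_core l p \<longleftrightarrow> is_partition p \<and> \<not> (\<exists>H. rim_hook l p H)"

definition has_nonhorizontal_hook :: "nat \<Rightarrow> (nat \<Rightarrow> nat) \<Rightarrow> bool" where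
  "has_nonhorizontal_hook l p \<longleftrightarrow> (\<exists>H. rim_hook l p H \<and> \<not> horizontal H)"

definition horizontal_removal :: "nat \<Rightarrow> (nat \<Rightarrow> nat) \<Rightarrow> (nat \<Rightarrow> nat) \<Rightarrow> bool" where
  "horizontal_removal l p q \<longleftrightarrow>
     (\<exists>H. rim_hook l p H \<and> horizontal H \<and> is_partition q \<and> diagram q = diagram p - H)"

definition is_l_partition :: "nat \<Rightarrow> (nat \<Rightarrow> nat) \<Rightarrow> bool" where
  "is_l_partition l p \<longleftrightarrow>
     is_partition p \<and> regular l p \<and> \<not> has_nonhorizontal_hook l p \<and>
     (\<forall>q. (horizontal_removal l)\<^sup>*\<^sup>* p q \<longrightarrow> \<not> has_nonhorizontal_hook l q)"


subsection \<open>The decomposition\<close>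

definition nu :: "nat \<Rightarrow> (nat \<Rightarrow> nat) \<Rightarrow> nat \<Rightarrow> nat \<Rightarrow> nat" where
  "nu l \<mu> r j = (if j < r then \<mu> 0 + (r - j) * (l - 1) else \<mu> (j - r))"

definition decomposes :: "nat \<Rightarrow> (nat \<Rightarrow> nat) \<Rightarrow> (nat \<Rightarrow> nat) \<Rightarrow> nat \<Rightarrow> (nat \<Rightarrow> nat) \<Rightarrow> bool" where
  "decomposes l p \<mu> r \<kappa> \<longleftrightarrow>
     is_core l \<mu> \<and> \<mu> 0 - \<mu> 1 \<noteq> l - 1 \<and>
     is_partition \<kappa> \<and> (\<forall>j>r. \<kappa> j = 0) \<and>
     (\<forall>j\<le>r. p j = nu l \<mu> r j + l * \<kappa> j) \<and>
     (\<forall>j>r. p j = nu l \<mu> r j)"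


subsection \<open>The crystal\<close>

definition has_residue :: "nat \<Rightarrow> nat \<Rightarrow> box \<Rightarrow> bool" where
  "has_residue l i x \<longleftrightarrow> (int (snd x) - int (fst x)) mod int l = int i mod int l"

definition removable_box :: "nat \<Rightarrow> nat \<Rightarrow> (nat \<Rightarrow> nat) \<Rightarrow> box \<Rightarrow> bool" where
  "removable_box l i p x \<longleftrightarrow>
     x \<in> diagram p \<and> has_residue l i x \<and> is_diagram (diagram p - {x})"

definition addable_box :: "nat \<Rightarrow> nat \<Rightarrow> (nat \<Rightarrow> nat) \<Rightarrow> box \<Rightarrow> bool" where
  "addable_box l i p x \<longleftrightarrow>
     x \<notin> diagram p \<and> has_residue l i x \<and> is_diagram (insert x (diagram p))"

datatype sign = Plus | Minus

text \<open>
  The i-signature, each sign paired with its box.  The rectangle that is scanned contains all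
  boxes and all addable positions of \<open>p\<close>; row 0 is the top row.
\<close>

definition signature :: "nat \<Rightarrow> nat \<Rightarrow> (nat \<Rightarrow> nat) \<Rightarrow> (sign \<times> box) list" where
  "signature l i p =
     map (\<lambda>x. (if removable_box l i p x then Minus else Plus, x))
       (filter (\<lambda>x. removable_box l i p x \<or> addable_box l i p x)
         (List.product (rev [0..<Suc (num_parts p)]) [0..<Suc (p 0)]))"

inductive cancel :: "(sign \<times> box) list \<Rightarrow> (sign \<times> box) list \<Rightarrow> bool" where
  "cancel (u @ (Minus, x) # (Plus, y) # v) (u @ v)"

definition reduction_of :: "(sign \<times> box) list \<Rightarrow> (sign \<times> box) list \<Rightarrow> bool" where
  "reduction_of s w \<longleftrightarrow> cancel\<^sup>*\<^sup>* s w \<and> \<not> (\<exists>w'. cancel w w')"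

definition reduced_signature :: "nat \<Rightarrow> nat \<Rightarrow> (nat \<Rightarrow> nat) \<Rightarrow> (sign \<times> box) list" where
  "reduced_signature l i p = (THE w. reduction_of (signature l i p) w)"

text \<open>The order of deletions is irrelevant, so \<open>reduced_signature\<close> is well defined.\<close>

fun push :: "sign \<times> box \<Rightarrow> (sign \<times> box) list \<Rightarrow> (sign \<times> box) list" where
  "push (Minus, x) ((Plus, y) # w) = w"
| "push s w = s # w"

lemma push_cases: "push s w = s # w \<or> (\<exists>x y. s = (Minus, x) \<and> w = (Plus, y) # push s w)"
  by (cases "(s, w)" rule: push.cases) auto

lemma foldr_push_cancel: "cancel s t \<Longrightarrow> foldr push s [] = foldr push t []"
proof (induction rule: cancel.induct)
  case (1 u x y v)
  have "push (Minus, x) (push (Plus, y) w) = w" for w by simp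
  then show ?case by simp
qed

lemma foldr_push_irreducible: "\<not> (\<exists>t. cancel s t) \<Longrightarrow> foldr push s [] = s"
proof (induction s)
  case (Cons a s)
  have "\<not> (\<exists>t. cancel s t)"
    using Cons.prems by (metis append_Cons cancel.simps)
  then have "foldr push s [] = s" by (rule Cons.IH)
  moreover have "\<not> (\<exists>x y v. a = (Minus, x) \<and> s = (Plus, y) # v)"
    using Cons.prems cancel.intros[of "[]"] by fastforce
  ultimately show ?case using push_cases[of a s] by auto
qed simp

lemma reduction_exists: "\<exists>w. reduction_of s w"
proof (induction s rule: length_induct)
  case (1 s)
  show ?case
  proof (cases "\<exists>t. cancel s t")
    case True
    then obtain t where t: "cancel s t" by blast
    then have "length t < length s" by cases auto
    with 1 obtain w where "reduction_of t w" by blast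
    with t show ?thesis
      unfolding reduction_of_def by (meson converse_rtranclp_into_rtranclp)
  qed (auto simp: reduction_of_def)
qed

lemma reduction_of_foldr: "reduction_of s w \<Longrightarrow> w = foldr push s []"
proof -
  assume w: "reduction_of s w"
  then have "cancel\<^sup>*\<^sup>* s w" by (simp add: reduction_of_def)
  then have "foldr push s [] = foldr push w []"
    by induction (auto dest: foldr_push_cancel)
  with w show ?thesis by (simp add: reduction_of_def foldr_push_irreducible)
qed

lemma reduction_unique: "\<exists>!w. reduction_of s w"
  using reduction_exists reduction_of_foldr by metis

definition normal_boxes :: "nat \<Rightarrow> nat \<Rightarrow> (nat \<Rightarrow> nat) \<Rightarrow> box list" where
  "normal_boxes l i p = map snd (filter (\<lambda>s. fst s = Minus) (reduced_signature l i p))"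

definition conormal_boxes :: "nat \<Rightarrow> nat \<Rightarrow> (nat \<Rightarrow> nat) \<Rightarrow> box list" where
  "conormal_boxes l i p = map snd (filter (\<lambda>s. fst s = Plus) (reduced_signature l i p))"

definition epsilon :: "nat \<Rightarrow> nat \<Rightarrow> (nat \<Rightarrow> nat) \<Rightarrow> nat" where
  "epsilon l i p = length (normal_boxes l i p)"

definition phi :: "nat \<Rightarrow> nat \<Rightarrow> (nat \<Rightarrow> nat) \<Rightarrow> nat" where
  "phi l i p = length (conormal_boxes l i p)"

definition first_row_conormal :: "nat \<Rightarrow> nat \<Rightarrow> (nat \<Rightarrow> nat) \<Rightarrow> bool" where
  "first_row_conormal l i p \<longleftrightarrow> (\<exists>x\<in>set (conormal_boxes l i p). fst x = 0)"

text \<open>\<open>None\<close> plays the role of the value 0 of the crystal operators.\<close>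

definition e_op :: "nat \<Rightarrow> nat \<Rightarrow> (nat \<Rightarrow> nat) \<Rightarrow> (nat \<Rightarrow> nat) option" where
  "e_op l i p =
     (if normal_boxes l i p = [] then None
      else let a = fst (hd (normal_boxes l i p)) in Some (p(a := p a - 1)))"

definition f_op :: "nat \<Rightarrow> nat \<Rightarrow> (nat \<Rightarrow> nat) \<Rightarrow> (nat \<Rightarrow> nat) option" where
  "f_op l i p =
     (if conormal_boxes l i p = [] then None
      else let a = fst (last (conormal_boxes l i p)) in Some (p(a := p a + 1)))"

definition f_power :: "nat \<Rightarrow> nat \<Rightarrow> nat \<Rightarrow> (nat \<Rightarrow> nat) \<Rightarrow> (nat \<Rightarrow> nat) option" where
  "f_power l i n p = ((\<lambda>m. Option.bind m (f_op l i)) ^^ n) (Some p)"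

end

theory Submission
  imports Defs
begin

text \<open>
  The proof works on the abacus, i.e. with the set of beads \<open>p a - a\<close>.
  Removing an \<open>l\<close>-rim hook moves a bead from \<open>x\<close> to \<open>x - l\<close>, and the hook is horizontal iff no
  bead is passed.  A partition is an \<open>l\<close>-partition iff above every gap that has a bead further up
  on its runner there are no beads on other runners.  In the signature of such a partition no
  \<open>-\<close> precedes a \<open>+\<close>, so nothing cancels: the (co)normal boxes are just the removable (addable)
  ones, and the crystal operators move beads between the runners of \<open>i\<close> and \<open>i + 1\<close>.  The result
  then is a comparison of the runner of the first row, which carries all non-flush beads, with
  these two runners.
\<close>

subsection \<open>Beads and rim hooks\<close>

text \<open>The numbers in the theorem describe one position, b = \<open>\<mu> 0 - r\<close>. Below
  b every runner is flush; at or above b only the runner of b carries beads, those of rows 0 to r.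
  So r + 1 counts the top beads, and \<open>\<kappa> r = 0\<close> says that the lowest of them sits
  at b. A crystal move destroys the gap condition when some gap has a bead above it on its own
  runner and another bead above it elsewhere. If the moves take place away from the runner of row 0,
  having at least two candidate rows already produces such a gap, with row 0 as the bead elsewhere.
  If they take place on that runner, all rows 0 to r - 1 are candidates, and trouble comes from a
  candidate row below r or from a last candidate that sits higher than it could. For e, row r drops
  out when both b and b - 1 are occupied; this is the alternative epsilon = r, where
  \<open>\<kappa> (r - 1) = 0\<close> says that row r - 1 sits at b + l.\<close>

definition bead :: "(nat \<Rightarrow> nat) \<Rightarrow> nat \<Rightarrow> int" where
  "bead p a = int (p a) - int a"

abbreviation beads :: "(nat \<Rightarrow> nat) \<Rightarrow> int set" where
  "beads p \<equiv> range (bead p)"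

lemma partition_le: "is_partition p \<Longrightarrow> a \<le> b \<Longrightarrow> p b \<le> p a"
  by (simp add: is_partition_def antimonoD)

lemma is_partition_iff:
  "is_partition p \<longleftrightarrow> (\<forall>a. p (Suc a) \<le> p a) \<and> finite {a. p a \<noteq> 0}"
  by (auto simp: is_partition_def antimono_iff_le_Suc)

lemma bead_strict: "is_partition p \<Longrightarrow> a < b \<Longrightarrow> bead p b < bead p a"
  using partition_le[of p a b] by (simp add: bead_def)

lemma bead_less_iff: "is_partition p \<Longrightarrow> bead p a < bead p b \<longleftrightarrow> b < a"
  by (metis bead_strict linorder_neqE_nat order_less_asym order_less_irrefl)

lemma bead_le_iff: "is_partition p \<Longrightarrow> bead p a \<le> bead p b \<longleftrightarrow> b \<le> a"
  by (metis bead_less_iff linorder_not_less)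

lemma bead_eq_iff: "is_partition p \<Longrightarrow> bead p a = bead p b \<longleftrightarrow> a = b"
  by (metis bead_less_iff linorder_neqE_nat order_less_irrefl)

lemma gap_between_beads:
  assumes "is_partition p" "bead p b > y" "bead p (Suc b) < y"
  shows "y \<notin> beads p"
proof
  assume "y \<in> beads p"
  then obtain c where "y = bead p c" by blast
  with assms show False by (auto simp: bead_less_iff)
qed

text \<open>Row \<open>b\<close> is where a bead moved down to \<open>y\<close> has to be sorted in,
  and so becomes the last row of the rim hook of that move. Only finitely many beads exceed
  \<open>y\<close>, so it can be taken maximal.\<close>

lemma ex_bead_above_gap:
  assumes p: "is_partition p" and y: "y \<notin> beads p" and a: "bead p a > y"
  obtains b where "a \<le> b" "bead p b > y" "bead p (Suc b) < y"
proof -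
  have "{b. bead p b > y} \<subseteq> {..nat (int (p 0) - y)}"
  proof
    fix b assume "b \<in> {b. bead p b > y}"
    then show "b \<in> {..nat (int (p 0) - y)}"
      using partition_le[OF p, of 0 b] by (simp add: bead_def)
  qed
  then have fin: "finite {b. bead p b > y}" by (rule finite_subset) simp
  let ?b = "Max {b. bead p b > y}"
  have b: "bead p ?b > y" "a \<le> ?b"
    using Max_in[OF fin] a Max_ge[OF fin] by auto
  have "\<not> bead p (Suc ?b) > y"
    using Max_ge[OF fin, of "Suc ?b"] by auto
  moreover have "bead p (Suc ?b) \<noteq> y" using y by (metis rangeI)
  ultimately show ?thesis using that b by force
qed

lemma diagram_inj: "diagram p = diagram q \<Longrightarrow> p = q"
proof
  fix a assume "diagram p = diagram q"
  then have "b < p a \<longleftrightarrow> b < q a" for b by (auto simp: diagram_def set_eq_iff)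
  then show "p a = q a" by (metis linorder_neqE_nat order_less_irrefl)
qed

lemma diagram_finite: "is_partition p \<Longrightarrow> finite (diagram p)"
proof -
  assume "is_partition p"
  moreover have "diagram p \<subseteq> Sigma {a. p a \<noteq> 0} (\<lambda>a. {..<p a})"
    by (auto simp: diagram_def)
  ultimately show ?thesis unfolding is_partition_def by (meson finite_SigmaI finite_lessThan finite_subset)
qed

text \<open>The shape of a rim hook \<open>p / q\<close> in the rows from \<open>a\<close> to \<open>b\<close>.\<close>

definition strip :: "(nat \<Rightarrow> nat) \<Rightarrow> (nat \<Rightarrow> nat) \<Rightarrow> nat \<Rightarrow> nat \<Rightarrow> bool" where
  "strip p q a b \<longleftrightarrow> a \<le> b \<and> (\<forall>j. j < a \<or> b < j \<longrightarrow> q j = p j) \<and>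
     (\<forall>j. a \<le> j \<and> j < b \<longrightarrow> p (Suc j) = Suc (q j)) \<and> q b < p b"

lemma strip_less:
  assumes p: "is_partition p" and s: "strip p q a b" and j: "a \<le> j" "j \<le> b"
  shows "q j < p j"
proof (cases "j = b")
  case False
  then have "p (Suc j) = Suc (q j)" using s j by (auto simp: strip_def)
  then show ?thesis using partition_le[OF p, of j "Suc j"] by simp
qed (use s in \<open>simp add: strip_def\<close>)

lemma strip_diff:
  assumes "is_partition p" "strip p q a b"
  shows "diagram p - diagram q = Sigma {a..b} (\<lambda>j. {q j..<p j})"
proof -
  have "j < a \<or> b < j \<Longrightarrow> q j = p j" for j using assms by (auto simp: strip_def)
  then show ?thesis by (auto simp: diagram_def) (metis not_less)+
qed

lemma strip_subset:
  assumes "is_partition p" "strip p q a b"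
  shows "diagram q \<subseteq> diagram p"
proof -
  have "q j \<le> p j" for j
    using assms strip_less[OF assms, of j] by (cases "a \<le> j \<and> j \<le> b") (auto simp: strip_def)
  then show ?thesis by (auto simp: diagram_def intro: less_le_trans)
qed

text \<open>Since \<open>p (Suc j) = Suc (q j)\<close>, the length of row \<open>j\<close> of the
  strip is the difference of two consecutive beads of \<open>p\<close>, and the sum
  telescopes.\<close>

lemma strip_card:
  assumes p: "is_partition p" and s: "strip p q a b"
  shows "int (card (diagram p - diagram q)) = bead p a - bead q b"
proof -
  have ab: "a \<le> b" using s by (simp add: strip_def)
  have tel: "a \<le> n \<Longrightarrow> n \<le> b \<Longrightarrow> (\<Sum>j=a..<n. int (p j - q j)) = bead p a - bead p n" for n
  proof (induction n rule: dec_induct)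
    case (step n)
    have "p (Suc n) = Suc (q n)" using s step by (auto simp: strip_def)
    moreover have "q n < p n" using strip_less[OF p s, of n] step by simp
    ultimately show ?case using step by (simp add: bead_def)
  qed simp
  have "int (card (diagram p - diagram q)) = (\<Sum>j=a..b. int (p j - q j))"
    by (simp add: strip_diff[OF p s])
  also have "\<dots> = (\<Sum>j=a..<b. int (p j - q j)) + int (p b - q b)"
    using ab by (simp add: sum.last_plus add.commute)
  also have "\<dots> = bead p a - bead q b"
    using tel[OF ab order_refl] s by (simp add: bead_def strip_def)
  finally show ?thesis .
qed

lemma strip_square:
  assumes p: "is_partition p" and s: "strip p q a b"
  shows "\<not> contains_square (diagram p - diagram q)"
proof
  assume "contains_square (diagram p - diagram q)"
  then obtain j c where sq: "{(j, c), (j, Suc c), (Suc j, c), (Suc j, Suc c)}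
      \<subseteq> Sigma {a..b} (\<lambda>j. {q j..<p j})"
    unfolding contains_square_def strip_diff[OF p s] by blast
  then have "p (Suc j) = Suc (q j)" using s by (auto simp: strip_def)
  with sq show False by auto
qed

lemma strip_connected:
  assumes p: "is_partition p" and s: "strip p q a b"
  shows "connected_boxes (diagram p - diagram q)"
proof -
  define H where "H = diagram p - diagram q"
  define E where "E = (\<lambda>u v. u \<in> H \<and> v \<in> H \<and> adjacent u v)"
  have H: "(j, c) \<in> H \<longleftrightarrow> a \<le> j \<and> j \<le> b \<and> q j \<le> c \<and> c < p j" for j c
    by (auto simp: H_def strip_diff[OF p s])
  have sym: "E\<^sup>*\<^sup>* v u" if "E\<^sup>*\<^sup>* u v" for u v
  proof -
    have "symp E" by (auto simp: symp_def E_def adjacent_def)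
    with that show ?thesis by (metis symp_rtranclp sympD)
  qed
  have row: "E\<^sup>*\<^sup>* (j, c) (j, p j - 1)" if "(j, c) \<in> H" for j c
    using that
  proof (induction "p j - 1 - c" arbitrary: c)
    case 0
    then have "c = p j - 1" using H[of j c] by auto
    then show ?case by simp
  next
    case (Suc n)
    then have c: "Suc c < p j" by auto
    with Suc.prems have S: "(j, Suc c) \<in> H" by (auto simp: H)
    have "n = p j - 1 - Suc c" using Suc by simp
    then have "E\<^sup>*\<^sup>* (j, Suc c) (j, p j - 1)" using Suc(1) S by blast
    moreover have "E (j, c) (j, Suc c)" using Suc.prems S by (auto simp: E_def adjacent_def)
    ultimately show ?case by (rule converse_rtranclp_into_rtranclp[rotated])
  qed
  \<comment> \<open>The last box of row \<open>Suc j\<close> is in column \<open>q j\<close>,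
    directly below the first box of row \<open>j\<close>, so the rows are chained through their
    ends.\<close>
  have col: "j \<le> b \<Longrightarrow> E\<^sup>*\<^sup>* (j, p j - 1) (a, p a - 1)" if "a \<le> j" for j
    using that
  proof (induction j rule: dec_induct)
    case (step j)
    have pS: "p (Suc j) - 1 = q j" "p (Suc j) = Suc (q j)" using s step by (auto simp: strip_def)
    have 1: "(j, q j) \<in> H" using step strip_less[OF p s, of j] by (simp add: H)
    have 2: "(Suc j, q j) \<in> H" using step pS strip_less[OF p s, of "Suc j"] by (simp add: H)
    have "E (Suc j, q j) (j, q j)" using 1 2 by (simp add: E_def adjacent_def)
    moreover have "E\<^sup>*\<^sup>* (j, q j) (a, p a - 1)"
      using row[OF 1] step by (simp add: rtranclp_trans)
    ultimately show ?case using pS by (simp add: converse_rtranclp_into_rtranclp)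
  qed simp
  have all: "E\<^sup>*\<^sup>* u (a, p a - 1)" if "u \<in> H" for u
    using row[of "fst u" "snd u"] col[of "fst u"] that H[of "fst u" "snd u"]
    by (simp add: rtranclp_trans)
  have "E\<^sup>*\<^sup>* u v" if "u \<in> H" "v \<in> H" for u v
    using all[OF that(1)] sym[OF all[OF that(2)]] by (rule rtranclp_trans)
  then show ?thesis by (simp add: connected_boxes_def H_def[symmetric] E_def[symmetric])
qed

lemma strip_horizontal:
  assumes p: "is_partition p" and s: "strip p q a b"
  shows "horizontal (diagram p - diagram q) \<longleftrightarrow> a = b"
proof
  assume "horizontal (diagram p - diagram q)"
  moreover have "(a, q a) \<in> diagram p - diagram q" "(b, q b) \<in> diagram p - diagram q"
    using s strip_less[OF p s] by (auto simp: strip_diff[OF p s] strip_def)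
  ultimately show "a = b" unfolding horizontal_def by (metis fst_conv)
next
  assume "a = b"
  then show "horizontal (diagram p - diagram q)"
    by (auto simp: horizontal_def strip_diff[OF p s])
qed

lemma strip_gap:
  assumes p: "is_partition p" and q: "is_partition q" and s: "strip p q a b"
  shows "bead q b \<notin> beads p"
proof (rule gap_between_beads[OF p])
  show "bead q b < bead p b" using s by (simp add: strip_def bead_def)
  have "bead p (Suc b) = bead q (Suc b)" using s by (simp add: strip_def bead_def)
  then show "bead p (Suc b) < bead q b" using bead_strict[OF q, of b "Suc b"] by simp
qed

text \<open>A connected set cannot jump over a row boundary, so consecutive rows of a rim hook overlap;
  the absence of a square bounds the overlap.\<close>

lemma connected_crossing:
  assumes H: "connected_boxes H" and u: "u \<in> H" "fst u \<le> j" and v: "v \<in> H" "j < fst v"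
  obtains c where "(j, c) \<in> H" "(Suc j, c) \<in> H"
proof (rule ccontr)
  assume no: "\<not> thesis"
  have "(\<lambda>u v. u \<in> H \<and> v \<in> H \<and> adjacent u v)\<^sup>*\<^sup>* u v"
    using H u v by (simp add: connected_boxes_def)
  then have "fst v \<le> j"
  proof (induction rule: rtranclp_induct)
    case (step x y)
    show ?case
    proof (rule ccontr)
      assume "\<not> fst y \<le> j"
      with step have "fst x = j" "fst y = Suc j" "snd x = snd y" by (auto simp: adjacent_def)
      with step have "(j, snd x) \<in> H" "(Suc j, snd x) \<in> H" by (metis prod.collapse)+
      with that no show False by blast
    qed
  qed (use u in simp)
  with v show False by simp
qed

lemma strip_of_rim_hook:
  assumes p: "is_partition p" and l: "0 < l" and H: "rim_hook l p H"
  obtains q a b where "is_partition q" "strip p q a b" "H = diagram p - diagram q"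
    "bead q b = bead p a - int l"
proof -
  obtain q where q: "is_partition q" and dq: "diagram q = diagram p - H"
    using H by (auto simp: rim_hook_def is_diagram_def)
  have Hq: "H = diagram p - diagram q" using dq H by (auto simp: rim_hook_def)
  have qp: "q j \<le> p j" for j
  proof (rule ccontr)
    assume "\<not> q j \<le> p j"
    then have "(j, p j) \<in> diagram q" "(j, p j) \<notin> diagram p" by (auto simp: diagram_def)
    with dq show False by blast
  qed
  have mem: "(j, c) \<in> H \<longleftrightarrow> q j \<le> c \<and> c < p j" for j c
    by (auto simp: Hq diagram_def)
  have fin: "finite H" using Hq diagram_finite[OF p] by simp
  have ne: "H \<noteq> {}" using H l by (auto simp: rim_hook_def)
  define a where "a = Min (fst ` H)"
  define b where "b = Max (fst ` H)"
  have "a \<in> fst ` H" "b \<in> fst ` H" using fin ne by (auto simp: a_def b_def)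
  then obtain u v where u: "u \<in> H" "fst u = a" and v: "v \<in> H" "fst v = b" by auto
  have ab: "a \<le> fst x \<and> fst x \<le> b" if "x \<in> H" for x
    using that fin by (auto simp: a_def b_def)
  have out: "q j = p j" if "j < a \<or> b < j" for j
  proof (rule ccontr)
    assume "q j \<noteq> p j"
    with qp[of j] have "(j, q j) \<in> H" by (simp add: mem)
    with ab[of "(j, q j)"] that show False by auto
  qed
  have "p (Suc j) = Suc (q j)" if j: "a \<le> j" "j < b" for j
  proof -
    obtain c where "(j, c) \<in> H" "(Suc j, c) \<in> H"
      using connected_crossing[of H u j v] H u v j by (auto simp: rim_hook_def)
    then have "q j < p (Suc j)" by (simp add: mem)
    moreover have "\<not> Suc (q j) < p (Suc j)"
    proof
      assume "Suc (q j) < p (Suc j)"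
      then have "{(j, q j), (j, Suc (q j)), (Suc j, q j), (Suc j, Suc (q j))} \<subseteq> H"
        using partition_le[OF p, of j "Suc j"] partition_le[OF q, of j "Suc j"] by (auto simp: mem)
      then show False using H unfolding rim_hook_def contains_square_def by blast
    qed
    ultimately show ?thesis by simp
  qed
  moreover have "q b < p b" using v mem[of b "snd v"] by (metis le_less_trans prod.collapse)
  moreover have "a \<le> b" using ab[OF u(1)] u by simp
  ultimately have s: "strip p q a b" using out by (simp add: strip_def)
  have "bead q b = bead p a - int l"
    using strip_card[OF p s] H Hq by (simp add: rim_hook_def)
  with q s Hq show ?thesis using that by blast
qed

lemma rim_hook_of_strip:
  assumes "is_partition p" "is_partition q" "strip p q a b" "bead q b = bead p a - int l"
  shows "rim_hook l p (diagram p - diagram q)"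
proof -
  have "diagram p - (diagram p - diagram q) = diagram q"
    using strip_subset[OF assms(1,3)] by blast
  then show ?thesis
    using assms strip_card[of p q a b] strip_connected[of p q a b] strip_square[of p q a b]
    by (auto simp: rim_hook_def is_diagram_def)
qed

lemma strip_of_gap:
  assumes p: "is_partition p" and l: "0 < l" and gap: "bead p a - int l \<notin> beads p"
  obtains q b where "is_partition q" "strip p q a b" "bead q b = bead p a - int l"
    "bead p b > bead p a - int l" "bead p (Suc b) < bead p a - int l"
proof -
  define y where "y = bead p a - int l"
  have "bead p a > y" using l by (simp add: y_def)
  then obtain b where b: "a \<le> b" "bead p b > y" "bead p (Suc b) < y"
    using ex_bead_above_gap[OF p gap[folded y_def]] by blast
  \<comment> \<open>The new row \<open>b\<close> has length \<open>y + int b\<close>; this bound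
    makes \<open>nat\<close> harmless and leaves room for row \<open>Suc b\<close>.\<close>
  have y: "y + int b \<ge> int (p (Suc b))" using b by (simp add: bead_def)
  \<comment> \<open>The beads sorted again after the move: those of rows a + 1 to b each rise by one
    row index, which costs one box because \<open>bead\<close> subtracts the index, and
    \<open>y\<close> becomes the bead of row \<open>b\<close>.\<close>
  define q where "q = (\<lambda>j. if j < a \<or> b < j then p j else if j < b then p (Suc j) - 1
    else nat (y + int b))"
  have pos: "p (Suc j) > 0" if "j < b" for j
    using partition_le[OF p, of "Suc j" b] that b y by (simp add: bead_def)
  have qb: "int (q b) = y + int b" using b y by (simp add: q_def)
  have s: "strip p q a b"
    unfolding strip_def using b pos qb by (auto simp: q_def bead_def)
  have "q (Suc j) \<le> q j" for j
  proof -
    have pp: "p (Suc j) \<le> p j" "p (Suc (Suc j)) \<le> p (Suc j)" "p j \<le> p (j - 1)"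
      using partition_le[OF p] by auto
    consider "Suc j < a \<or> b < j" | "Suc j = a" | "a \<le> j" "Suc j < b" | "a \<le> j" "Suc j = b" | "j = b"
      by linarith
    then show ?thesis
    proof cases
      case 2
      then have "q j = p j" by (simp add: q_def)
      then show ?thesis using strip_less[OF p s, of a] b 2 pp by simp
    next
      case 4
      then have "int (p (Suc j)) > int (q (Suc j))" using qb b by (simp add: bead_def)
      moreover have "q j = p (Suc j) - 1" using 4 by (simp add: q_def)
      ultimately show ?thesis by simp
    next
      case 5
      then have "q (Suc j) = p (Suc j)" by (simp add: q_def)
      then show ?thesis using qb y 5 by simp
    qed (use pp in \<open>auto simp: q_def\<close>)
  qed
  moreover have "{j. q j \<noteq> 0} \<subseteq> {j. p j \<noteq> 0} \<union> {..b}" by (auto simp: q_def)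
  then have "finite {j. q j \<noteq> 0}"
    by (rule finite_subset) (use p in \<open>simp add: is_partition_def\<close>)
  ultimately have "is_partition q" by (simp add: is_partition_iff)
  then show ?thesis using that[of q b] s qb b by (simp add: bead_def y_def)
qed

lemma bead_row:
  "strip p q a a \<Longrightarrow> bead q = (bead p)(a := bead q a)"
  by (rule ext) (auto simp: strip_def bead_def neq_iff)

lemma beads_upd:
  assumes "is_partition p" "bead q = (bead p)(a := z)"
  shows "beads q = insert z (beads p - {bead p a})"
  using assms(2) bead_eq_iff[OF assms(1)] by (auto simp: image_iff)

text \<open>A bead with a vacant place \<open>l\<close> below it could move there, and that move is
  the removal of a rim hook.\<close>

lemma core_flush:
  assumes "is_core l p" "0 < l" "x \<in> beads p"
  shows "x - int l \<in> beads p"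
proof (rule ccontr)
  assume "x - int l \<notin> beads p"
  moreover obtain a where "x = bead p a" using assms by blast
  moreover have "is_partition p" using assms by (simp add: is_core_def)
  ultimately show False
    using assms strip_of_gap[of p l a] rim_hook_of_strip[of p _ a] by (metis is_core_def)
qed

subsection \<open>Partitions with the gap condition\<close>

text \<open>The abacus form of an \<open>l\<close>-partition: above a gap that has a bead further up on its own
  runner there are no beads on other runners.\<close>

definition gap_cond :: "nat \<Rightarrow> int set \<Rightarrow> bool" where
  "gap_cond l B \<longleftrightarrow> (\<forall>g x y. g \<notin> B \<longrightarrow> x \<in> B \<longrightarrow> y \<in> B \<longrightarrow> g < x \<longrightarrow> g < y \<longrightarrow>
     int l dvd x - g \<longrightarrow> int l dvd y - g)"

lemma gap_condD:
  "gap_cond l B \<Longrightarrow> g \<notin> B \<Longrightarrow> x \<in> B \<Longrightarrow> y \<in> B \<Longrightarrow> g < x \<Longrightarrow> g < y \<Longrightarrow> int l dvd x - g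
    \<Longrightarrow> int l dvd y - g"
  unfolding gap_cond_def by blast

lemma dvd_diff_sym: "(d::int) dvd x - y \<Longrightarrow> d dvd y - x"
  by (simp add: dvd_diff_commute)

lemma dvd_diff_ge: "(d::int) dvd x - y \<Longrightarrow> y < x \<Longrightarrow> y + d \<le> x"
  using zdvd_imp_le[of d "x - y"] by simp

lemma dvd_diff_eq: "(d::int) dvd x - y \<Longrightarrow> x < y + d \<Longrightarrow> y < x + d \<Longrightarrow> x = y"
  using dvd_diff_ge[of d x y] dvd_diff_ge[of d y x] dvd_diff_sym[of d x y] by linarith

lemma dvd_shift: "(d::int) dvd x - d - y \<longleftrightarrow> d dvd x - y" "d dvd x - (y - d) \<longleftrightarrow> d dvd x - y"
  using dvd_add_left_iff[of d d "x - y"] dvd_diff_left_iff[of d d "x - y"]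
  by (simp_all add: algebra_simps)

text \<open>The part of \<open>is_l_partition\<close> that passes visibly to the results of
  horizontal removals, as the induction requires; \<open>gap_cond_regular\<close> supplies
  regularity.\<close>

definition stable :: "nat \<Rightarrow> (nat \<Rightarrow> nat) \<Rightarrow> bool" where
  "stable l p \<longleftrightarrow> is_partition p \<and>
     (\<forall>q. (horizontal_removal l)\<^sup>*\<^sup>* p q \<longrightarrow> \<not> has_nonhorizontal_hook l q)"

text \<open>Moving \<open>x\<close> to the gap removes a rim hook, which stability forces to be
  horizontal. Its last row is then its first row, so no bead is passed, and the move is one of the
  removals under which stability persists.\<close>

lemma stable_move:
  assumes st: "stable l p" and l: "0 < l" and x: "x \<in> beads p" and gap: "x - int l \<notin> beads p"
  shows "\<forall>y\<in>beads p. x - int l < y \<longrightarrow> x \<le> y"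
    and "\<exists>q. stable l q \<and> beads q = insert (x - int l) (beads p - {x})"
proof -
  have p: "is_partition p" using st by (simp add: stable_def)
  obtain a where a: "x = bead p a" using x by blast
  obtain q b where q: "is_partition q" "strip p q a b" "bead q b = bead p a - int l"
    "bead p (Suc b) < bead p a - int l"
    using strip_of_gap[OF p l] gap unfolding a by metis
  have rim: "rim_hook l p (diagram p - diagram q)" using rim_hook_of_strip[OF p q(1-3)] .
  have "\<not> has_nonhorizontal_hook l p" using st by (auto simp: stable_def)
  then have hor: "horizontal (diagram p - diagram q)"
    using rim by (auto simp: has_nonhorizontal_hook_def)
  then have b: "b = a" using strip_horizontal[OF p q(2)] by simp
  have "x \<le> y" if y: "y \<in> beads p" "x - int l < y" for y
  proof -
    obtain c where "y = bead p c" using y by blast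
    moreover from this have "c < Suc a" using y q(4) b a by (simp flip: bead_less_iff[OF p])
    ultimately show ?thesis using a by (simp add: bead_le_iff[OF p])
  qed
  then show "\<forall>y\<in>beads p. x - int l < y \<longrightarrow> x \<le> y" by blast
  have "diagram q = diagram p - (diagram p - diagram q)"
    using strip_subset[OF p q(2)] by blast
  then have "horizontal_removal l p q"
    using rim hor q(1) unfolding horizontal_removal_def by blast
  then have "stable l q"
    using st q(1) unfolding stable_def by (metis converse_rtranclp_into_rtranclp)
  moreover have "beads q = insert (x - int l) (beads p - {x})"
    using beads_upd[OF p, of q a "x - int l"] bead_row[of p q a] q a b by simp
  ultimately show "\<exists>q. stable l q \<and> beads q = insert (x - int l) (beads p - {x})" by blast
qed

text \<open>A violation of the gap condition can be pushed down, by horizontal removals or by passing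
  to a lower bead of the same runner, until it becomes a non-horizontal hook.\<close>

lemma stable_gap_cond_aux:
  assumes "stable l p" "0 < l" "g \<notin> beads p" "x \<in> beads p" "y \<in> beads p" "g < x" "g < y"
    "int l dvd x - g" "\<not> int l dvd y - g"
  shows False
  using assms
proof (induction "nat (x - g + (y - g))" arbitrary: p x y rule: less_induct)
  case less
  have xy: "x \<noteq> y" using less.prems by auto
  have xg: "g + int l \<le> x" using dvd_diff_ge[of "int l" x g] less.prems by simp
  show False
  proof (cases "x = g + int l")
    case False
    then have xl: "g < x - int l" using xg by linarith
    have d: "int l dvd (x - int l) - g" using less.prems
      by (simp add: dvd_shift)
    have m: "nat ((x - int l) - g + (y - g)) < nat (x - g + (y - g))" using less.prems by simp
    show False
    proof (cases "x - int l \<in> beads p")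
      case True
      show False
        by (rule less.hyps[OF m less.prems(1-3) True less.prems(5) xl less.prems(7) d less.prems(9)])
    next
      case False
      then obtain q where q: "stable l q" "beads q = insert (x - int l) (beads p - {x})"
        using stable_move(2)[OF less.prems(1,2,4)] by blast
      show False
        by (rule less.hyps[OF m q(1) less.prems(2) _ _ _ xl less.prems(7) d less.prems(9)])
          (use q less.prems xl xy in auto)
    qed
  next
    case True
    then have "x - int l \<notin> beads p" using less.prems by simp
    \<comment> \<open>Here \<open>x\<close> can move onto \<open>g\<close> itself, so
      \<open>y\<close> cannot lie in between. It lies beyond \<open>x\<close>, hence can be lowered
      by \<open>l\<close> and stay above \<open>g\<close>.\<close>
    then have xley: "x < y"
      using bspec[OF stable_move(1)[OF less.prems(1,2,4)] less.prems(5)] less.prems(7) True xy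
      by simp
    have yl: "g < y - int l" using True xley by simp
    have d: "\<not> int l dvd (y - int l) - g" using less.prems
      by (simp add: dvd_shift)
    have m: "nat (x - g + (y - int l - g)) < nat (x - g + (y - g))" using less.prems by simp
    show False
    proof (cases "y - int l \<in> beads p")
      case t: True
      show False
        by (rule less.hyps[OF m less.prems(1-4) t less.prems(6) yl less.prems(8) d])
    next
      case f: False
      obtain q where q: "stable l q" "beads q = insert (y - int l) (beads p - {y})"
        using stable_move(2)[OF less.prems(1,2,5) f] by blast
      show False
        by (rule less.hyps[OF m q(1) less.prems(2) _ _ _ less.prems(6) yl less.prems(8) d])
          (use q less.prems yl xy in auto)
    qed
  qed
qed

section \<open>From the gap condition back to l-partitions\<close>

lemma gap_cond_no_nonhorizontal:
  assumes p: "is_partition p" and l: "0 < l" and g: "gap_cond l (beads p)"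
  shows "\<not> has_nonhorizontal_hook l p"
proof
  assume "has_nonhorizontal_hook l p"
  then obtain H where H: "rim_hook l p H" "\<not> horizontal H"
    by (auto simp: has_nonhorizontal_hook_def)
  then obtain q a b where q: "is_partition q" "strip p q a b" "H = diagram p - diagram q"
    "bead q b = bead p a - int l"
    using strip_of_rim_hook[OF p l] by metis
  have "a \<noteq> b" using strip_horizontal[OF p q(2)] q H by simp
  then have ab: "a < b" using q by (simp add: strip_def)
  \<comment> \<open>The bead of the last row \<open>b\<close> lies strictly between this gap and the
    moved bead, thus less than \<open>l\<close> above the gap and off its runner.\<close>
  have gap: "bead p a - int l \<notin> beads p" using strip_gap[OF p q(1,2)] q by simp
  have lt: "bead p a - int l < bead p b" using q by (simp add: strip_def bead_def)
  have "int l dvd bead p b - (bead p a - int l)"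
    using gap_condD[OF g gap _ _ _ lt, of "bead p a"] l by simp
  then have "bead p a \<le> bead p b" using dvd_diff_ge[of "int l" "bead p b" "bead p a - int l"] lt by simp
  then show False using ab by (simp add: bead_le_iff[OF p])
qed

text \<open>The only new gap is \<open>z\<close>, and the gap condition at the old gap
  \<open>z - int l\<close> already puts all beads above it on the runner of
  \<open>z\<close>.\<close>

lemma gap_cond_horizontal_removal:
  assumes p: "is_partition p" and l: "0 < l" and g: "gap_cond l (beads p)"
    and hr: "horizontal_removal l p q"
  shows "is_partition q \<and> gap_cond l (beads q)"
proof -
  obtain H where H: "rim_hook l p H" "horizontal H" and q: "is_partition q"
    and dq: "diagram q = diagram p - H"
    using hr by (auto simp: horizontal_removal_def)
  obtain q' a b where q': "is_partition q'" "strip p q' a b" "H = diagram p - diagram q'"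
    "bead q' b = bead p a - int l"
    using strip_of_rim_hook[OF p l H(1)] by metis
  have "diagram q' = diagram q" using dq q' strip_subset[OF p q'(2)] by blast
  then have "q' = q" by (rule diagram_inj)
  moreover have "a = b" using strip_horizontal[OF p q'(2)] q' H by simp
  ultimately have s: "strip p q a a" "bead q a = bead p a - int l" using q' by auto
  define z where "z = bead p a"
  have z: "z \<in> beads p" by (simp add: z_def)
  have Bq: "beads q = insert (z - int l) (beads p - {z})"
    using beads_upd[OF p bead_row[OF s(1)]] s(2) by (simp add: z_def)
  have gz: "z - int l \<notin> beads p" using strip_gap[OF p q s(1)] s(2) by (simp add: z_def)
  have *: "int l dvd y - (z - int l)" if "y \<in> beads p" "z - int l < y" for y
    using gap_condD[OF g gz z that(1) _ that(2)] l by simp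
  have "gap_cond l (beads q)"
    unfolding gap_cond_def
  proof (intro allI impI)
    fix h x y
    assume a: "h \<notin> beads q" "x \<in> beads q" "y \<in> beads q" "h < x" "h < y" "int l dvd x - h"
    show "int l dvd y - h"
    proof (cases "h = z")
      case True
      then have "y \<in> beads p" "z - int l < y" using a Bq by auto
      then have "int l dvd y - (z - int l)" using * by blast
      then show ?thesis using True by (simp add: dvd_shift)
    next
      case False
      then have h: "h \<notin> beads p" using a Bq by blast
      \<comment> \<open>Undoes the move: a bead of \<open>q\<close> is sent to a bead of
        \<open>p\<close> on the same runner and not lower, so the condition at an old gap carries
        over.\<close>
      define up where "up u = (if u = z - int l then z else u)" for u
      have up: "up u \<in> beads p \<and> h < up u \<and> (int l dvd up u - h \<longleftrightarrow> int l dvd u - h)"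
        if "u \<in> beads q" "h < u" for u
      proof (cases "u = z - int l")
        case True
        have "int l dvd z - h \<longleftrightarrow> int l dvd z - int l - h"
          by (simp add: dvd_shift)
        then show ?thesis using True that z by (simp add: up_def)
      qed (use that Bq in \<open>auto simp: up_def\<close>)
      show ?thesis using gap_condD[OF g h, of "up x" "up y"] up[OF a(2,4)] up[OF a(3,5)] a(6)
        by simp
    qed
  qed
  with q show ?thesis by blast
qed

text \<open>Equal parts are consecutive beads. With \<open>l\<close> of them, the gap just below the
  lowest has a bead exactly \<open>l\<close> above it, while the lowest bead is only 1 above
  it.\<close>

lemma gap_cond_regular:
  assumes p: "is_partition p" and l: "2 \<le> l" and g: "gap_cond l (beads p)"
  shows "regular l p"
  unfolding regular_def
proof (intro allI impI, rule ccontr)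
  fix n assume n: "(0::nat) < n" and c: "\<not> card {a. p a = n} < l"
  define S where "S = {a. p a = n}"
  have "S \<subseteq> {a. p a \<noteq> 0}" using n by (auto simp: S_def)
  then have fin: "finite S" by (rule finite_subset) (use p in \<open>simp add: is_partition_def\<close>)
  have "l \<le> card S" using c by (simp add: S_def)
  then have ne: "S \<noteq> {}" using l by force
  define b where "b = Max S"
  define a where "a = Min S"
  have ab: "p a = n" "p b = n" using Max_in[OF fin ne] Min_in[OF fin ne] by (auto simp: S_def a_def b_def)
  have "S \<subseteq> {a..b}" using fin by (auto simp: a_def b_def)
  then have "card S \<le> Suc b - a" using card_mono[of "{a..b}" S] by simp
  then have la: "a + l \<le> Suc b" using c l by (simp add: S_def)
  \<comment> \<open>The row whose bead is \<open>l\<close> above the gap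
    \<open>bead p b - 1\<close>.\<close>
  define d where "d = Suc b - l"
  have d: "a \<le> d" "d \<le> b" "int d = int b + 1 - int l" using la l by (auto simp: d_def)
  have pd: "p d = n" using partition_le[OF p d(1)] partition_le[OF p d(2)] ab by simp
  have "Suc b \<notin> S" using Max_ge[OF fin, of "Suc b"] by (auto simp: b_def)
  then have pS: "p (Suc b) < n" using partition_le[OF p, of b "Suc b"] ab by (simp add: S_def)
  define y where "y = bead p b - 1"
  have "y \<notin> beads p" by (rule gap_between_beads[OF p, of _ b]) (use pS ab in \<open>auto simp: y_def bead_def\<close>)
  moreover have "bead p d - y = int l" using d pd ab by (simp add: y_def bead_def)
  ultimately have "int l dvd bead p b - y"
    using gap_condD[OF g, of y "bead p d" "bead p b"] l by (simp add: y_def)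
  then show False using l by (simp add: y_def)
qed

lemma l_partition_iff_gap_cond:
  assumes p: "is_partition p" and l: "2 \<le> l"
  shows "is_l_partition l p \<longleftrightarrow> gap_cond l (beads p)"
proof
  assume "is_l_partition l p"
  then have "stable l p" by (auto simp: is_l_partition_def stable_def)
  then show "gap_cond l (beads p)"
    unfolding gap_cond_def using stable_gap_cond_aux[of l p] l by fastforce
next
  assume g: "gap_cond l (beads p)"
  have "is_partition q \<and> gap_cond l (beads q)" if "(horizontal_removal l)\<^sup>*\<^sup>* p q" for q
    using that
  proof (induction rule: rtranclp_induct)
    case (step q r)
    then show ?case using gap_cond_horizontal_removal[of q l r] l by simp
  qed (use p g in simp)
  then show "is_l_partition l p"
    using gap_cond_no_nonhorizontal[of _ l] gap_cond_regular[OF p l g] p l g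
    by (simp add: is_l_partition_def)
qed

subsection \<open>Signatures without cancellation\<close>

text \<open>With rows and columns counted from 0, \<open>bead p a\<close> is the content of the
  first position to the right of row \<open>a\<close>, and \<open>bead p a - 1\<close> that of its
  last box. Residues of boxes thus become runners, and the vacant neighbour says that the result is
  again a partition.\<close>

definition add_rows :: "nat \<Rightarrow> nat \<Rightarrow> (nat \<Rightarrow> nat) \<Rightarrow> nat set" where
  "add_rows l i p = {a. int l dvd bead p a - int i \<and> bead p a + 1 \<notin> beads p}"

definition rem_rows :: "nat \<Rightarrow> nat \<Rightarrow> (nat \<Rightarrow> nat) \<Rightarrow> nat set" where
  "rem_rows l i p = {a. int l dvd bead p a - 1 - int i \<and> bead p a - 1 \<notin> beads p}"

lemma bead_plus_gap_iff:
  assumes p: "is_partition p"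
  shows "bead p a + 1 \<notin> beads p \<longleftrightarrow> a = 0 \<or> p a < p (a - 1)"
proof (cases a)
  case 0
  have "bead p 0 + 1 \<noteq> bead p c" for c using bead_le_iff[OF p, of c 0] by linarith
  then show ?thesis using 0 by blast
next
  case (Suc b)
  show ?thesis
  proof
    assume "bead p a + 1 \<notin> beads p"
    then have "bead p b \<noteq> bead p a + 1" by (metis rangeI)
    then show "a = 0 \<or> p a < p (a - 1)"
      using Suc partition_le[OF p, of b a] by (simp add: bead_def)
  next
    assume r: "a = 0 \<or> p a < p (a - 1)"
    show "bead p a + 1 \<notin> beads p"
      by (rule gap_between_beads[OF p, of _ b]) (use r Suc in \<open>auto simp: bead_def\<close>)
  qed
qed

lemma bead_minus_gap_iff:
  assumes p: "is_partition p"
  shows "bead p a - 1 \<notin> beads p \<longleftrightarrow> p (Suc a) < p a"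
proof
  assume "bead p a - 1 \<notin> beads p"
  then have "bead p (Suc a) \<noteq> bead p a - 1" by (metis rangeI)
  then show "p (Suc a) < p a"
    using partition_le[OF p, of a "Suc a"] by (simp add: bead_def)
next
  assume r: "p (Suc a) < p a"
  show "bead p a - 1 \<notin> beads p"
    by (rule gap_between_beads[OF p, of _ a]) (use r in \<open>auto simp: bead_def\<close>)
qed

lemma is_partition_upd:
  assumes p: "is_partition p" and "p (Suc a) \<le> n" and "a = 0 \<or> n \<le> p (a - 1)"
  shows "is_partition (p(a := n))"
proof -
  have "(p(a := n)) (Suc j) \<le> (p(a := n)) j" for j
    using assms partition_le[OF p, of j "Suc j"] by auto
  moreover have "{j. (p(a := n)) j \<noteq> 0} \<subseteq> insert a {j. p j \<noteq> 0}" by auto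
  then have "finite {j. (p(a := n)) j \<noteq> 0}"
    by (rule finite_subset) (use p in \<open>simp add: is_partition_def\<close>)
  ultimately show ?thesis by (simp add: is_partition_iff)
qed

lemma insert_box_is_diagram_iff:
  assumes p: "is_partition p"
  shows "(a, c) \<notin> diagram p \<and> is_diagram (insert (a, c) (diagram p))
      \<longleftrightarrow> c = p a \<and> (a = 0 \<or> p a < p (a - 1))" (is "?L \<longleftrightarrow> ?R")
proof
  assume ?L
  then obtain q where q: "is_partition q" "diagram q = insert (a, c) (diagram p)"
    and n: "p a \<le> c" by (auto simp: is_diagram_def diagram_def)
  have mem: "d < q j \<longleftrightarrow> (j, d) = (a, c) \<or> d < p j" for j d
    using q(2) by (auto simp: diagram_def set_eq_iff)
  have "c < q a" using mem[of c a] by simp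
  then have c: "c = p a" using n mem[of "p a" a] by auto
  moreover have "p a < p (a - 1)" if "a \<noteq> 0"
  proof -
    have "c < q (a - 1)" using \<open>c < q a\<close> partition_le[OF q(1), of "a - 1" a] by simp
    then show ?thesis using mem[of c "a - 1"] that c by auto
  qed
  ultimately show ?R by blast
next
  assume R: ?R
  then have "is_partition (p(a := Suc (p a)))"
    by (intro is_partition_upd[OF p]) (use partition_le[OF p, of a "Suc a"] in auto)
  moreover have "diagram (p(a := Suc (p a))) = insert (a, c) (diagram p)"
    using R by (auto simp: diagram_def less_Suc_eq split: if_splits)
  ultimately have "is_diagram (insert (a, c) (diagram p))" unfolding is_diagram_def by blast
  then show ?L using R by (simp add: diagram_def)
qed

lemma remove_box_is_diagram_iff:
  assumes p: "is_partition p"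
  shows "(a, c) \<in> diagram p \<and> is_diagram (diagram p - {(a, c)})
      \<longleftrightarrow> Suc c = p a \<and> p (Suc a) < p a" (is "?L \<longleftrightarrow> ?R")
proof
  assume ?L
  then obtain q where q: "is_partition q" "diagram q = diagram p - {(a, c)}"
    and n: "c < p a" by (auto simp: is_diagram_def diagram_def)
  have mem: "d < q j \<longleftrightarrow> (j, d) \<noteq> (a, c) \<and> d < p j" for j d
    using q(2) by (auto simp: diagram_def set_eq_iff)
  have "q a \<le> c" using mem[of c a] by simp
  then have c: "Suc c = p a" using n mem[of "Suc c" a] by auto
  moreover have "p (Suc a) < p a"
  proof -
    have "q (Suc a) \<le> c" using \<open>q a \<le> c\<close> partition_le[OF q(1), of a "Suc a"] by simp
    then show ?thesis using mem[of c "Suc a"] c by auto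
  qed
  ultimately show ?R by blast
next
  assume R: ?R
  then have "is_partition (p(a := c))"
    by (intro is_partition_upd[OF p]) (use partition_le[OF p, of "a - 1" a] in auto)
  moreover have "diagram (p(a := c)) = diagram p - {(a, c)}"
    using R by (auto simp: diagram_def split: if_splits)
  ultimately have "is_diagram (diagram p - {(a, c)})" unfolding is_diagram_def by metis
  then show ?L using R by (auto simp: diagram_def)
qed

lemma has_residue_iff: "has_residue l i (a, c) \<longleftrightarrow> int l dvd int c - int a - int i"
  by (simp add: has_residue_def mod_eq_dvd_iff)

lemma addable_box_iff:
  assumes p: "is_partition p"
  shows "addable_box l i p (a, c) \<longleftrightarrow> a \<in> add_rows l i p \<and> c = p a"
  using insert_box_is_diagram_iff[OF p, of a c] bead_plus_gap_iff[OF p, of a]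
  by (auto simp: addable_box_def add_rows_def has_residue_iff bead_def)

lemma removable_box_iff:
  assumes p: "is_partition p"
  shows "removable_box l i p (a, c) \<longleftrightarrow> a \<in> rem_rows l i p \<and> c = p a - 1"
proof -
  have "removable_box l i p (a, c) \<longleftrightarrow> Suc c = p a \<and> p (Suc a) < p a \<and> int l dvd int c - int a - int i"
    using remove_box_is_diagram_iff[OF p, of a c]
    by (auto simp: removable_box_def has_residue_iff)
  moreover have "int c - int a = bead p a - 1" if "Suc c = p a"
    unfolding bead_def using that by linarith
  moreover have "Suc c = p a \<longleftrightarrow> c = p a - 1" if "p (Suc a) < p a" using that by auto
  ultimately show ?thesis
    unfolding rem_rows_def mem_Collect_eq bead_minus_gap_iff[OF p] by metis
qed

lemma add_rows_disjoint: "2 \<le> l \<Longrightarrow> add_rows l i p \<inter> rem_rows l i p = {}"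
proof -
  assume l: "2 \<le> l"
  have False if "int l dvd x - int i" "int l dvd x - 1 - int i" for x
    using dvd_diff[OF that] l by simp
  then show ?thesis by (auto simp: add_rows_def rem_rows_def)
qed

lemma less_num_parts:
  assumes p: "is_partition p" and a: "p a \<noteq> 0"
  shows "a < num_parts p"
proof -
  have "{..a} \<subseteq> {b. p b \<noteq> 0}" using partition_le[OF p, of _ a] a by force
  then have "card {..a} \<le> num_parts p"
    using p unfolding num_parts_def by (intro card_mono) (auto simp: is_partition_def)
  then show ?thesis by simp
qed

lemma add_rows_le:
  assumes p: "is_partition p" and a: "a \<in> add_rows l i p"
  shows "a \<le> num_parts p"
proof (cases a)
  case (Suc b)
  then have "p b \<noteq> 0" using a bead_plus_gap_iff[OF p, of a] by (auto simp: add_rows_def)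
  then show ?thesis using less_num_parts[OF p] Suc by fastforce
qed simp

lemma rem_rows_pos:
  assumes p: "is_partition p" and a: "a \<in> rem_rows l i p"
  shows "0 < p a"
  using a bead_minus_gap_iff[OF p, of a] by (auto simp: rem_rows_def)

lemma finite_add_rows: "is_partition p \<Longrightarrow> finite (add_rows l i p)"
  by (rule finite_subset[of _ "{..num_parts p}"]) (auto dest: add_rows_le)

lemma finite_rem_rows: "is_partition p \<Longrightarrow> finite (rem_rows l i p)"
proof (rule finite_subset)
  show "is_partition p \<Longrightarrow> rem_rows l i p \<subseteq> {a. p a \<noteq> 0}"
    using rem_rows_pos by fastforce
qed (simp add: is_partition_def)

text \<open>No \<open>-\<close> of the signature stands to the left of a \<open>+\<close>, so nothing cancels.\<close>

definition reduced :: "nat \<Rightarrow> nat \<Rightarrow> (nat \<Rightarrow> nat) \<Rightarrow> bool" where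
  "reduced l i p \<longleftrightarrow> (\<forall>a\<in>add_rows l i p. \<forall>b\<in>rem_rows l i p. b < a)"

lemma sorted_wrt_product:
  "sorted_wrt (\<ge>) (xs :: nat list) \<Longrightarrow>
    sorted_wrt (\<lambda>x y. fst y \<le> fst x) (List.product xs (ys :: nat list))"
proof (induction xs)
  case (Cons x xs)
  have "sorted_wrt (\<lambda>u v. fst v \<le> fst u) (map (Pair x) ys)"
    by (simp add: sorted_wrt_map)
  with Cons show ?case by (auto simp: sorted_wrt_append)
qed simp

definition boxes :: "nat \<Rightarrow> nat \<Rightarrow> (nat \<Rightarrow> nat) \<Rightarrow> box list" where
  "boxes l i p = filter (\<lambda>x. removable_box l i p x \<or> addable_box l i p x)
     (List.product (rev [0..<Suc (num_parts p)]) [0..<Suc (p 0)])"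

lemma signature_boxes:
  "signature l i p = map (\<lambda>x. (if removable_box l i p x then Minus else Plus, x)) (boxes l i p)"
  by (simp add: signature_def boxes_def)

lemma sorted_boxes: "sorted_wrt (\<lambda>x y. fst y \<le> fst x) (boxes l i p)"
proof -
  have "sorted_wrt (\<ge>) (rev [0..<Suc (num_parts p)])"
    unfolding sorted_wrt_rev by (simp del: upt_Suc)
  then show ?thesis unfolding boxes_def by (intro sorted_wrt_filter sorted_wrt_product)
qed

lemma distinct_boxes: "distinct (boxes l i p)"
  unfolding boxes_def by (intro distinct_filter distinct_product) (auto simp del: upt_Suc)

text \<open>The rectangle scanned by \<open>signature\<close> exceeds the diagram by one row and one
  column, enough to contain every addable position.\<close>

lemma set_boxes:
  assumes p: "is_partition p"
  shows "x \<in> set (boxes l i p) \<longleftrightarrow> removable_box l i p x \<or> addable_box l i p x"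
proof -
  obtain a c where x: "x = (a, c)" by (cases x)
  have "a \<le> num_parts p \<and> c \<le> p 0" if "removable_box l i p x \<or> addable_box l i p x"
    using that unfolding x removable_box_iff[OF p] addable_box_iff[OF p]
  proof
    assume r: "a \<in> rem_rows l i p \<and> c = p a - 1"
    then have "p a \<noteq> 0" using rem_rows_pos[OF p] by fastforce
    then show ?thesis using r less_num_parts[OF p, of a] partition_le[OF p, of 0 a] by simp
  next
    assume "a \<in> add_rows l i p \<and> c = p a"
    then show ?thesis using add_rows_le[OF p] partition_le[OF p, of 0 a] by auto
  qed
  then show ?thesis unfolding boxes_def x by (auto simp del: upt_Suc simp: less_Suc_eq_le)
qed

text \<open>The scan runs from the bottom row upwards, so an adjacent pair -+ would have its addable
  row at or above its removable row, against \<open>reduced\<close>. The signature is thus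
  irreducible, and reductions are unique.\<close>

lemma reduced_signature_eq:
  assumes p: "is_partition p" and r: "reduced l i p"
  shows "reduced_signature l i p = signature l i p"
proof -
  have "\<not> cancel (signature l i p) w" for w
  proof
    assume "cancel (signature l i p) w"
    then obtain u x y v where s: "signature l i p = u @ (Minus, x) # (Plus, y) # v"
      by (auto elim: cancel.cases)
    have mem: "(Minus, x) \<in> set (signature l i p)" "(Plus, y) \<in> set (signature l i p)"
      by (simp_all add: s)
    have x: "removable_box l i p x" and y: "addable_box l i p y"
      using mem by (auto simp: signature_boxes set_boxes[OF p] split: if_splits)
    have "map snd (signature l i p) = boxes l i p"
      by (simp add: signature_boxes comp_def)
    then have "sorted_wrt (\<lambda>x y. fst y \<le> fst x) (map snd (signature l i p))"
      using sorted_boxes by simp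
    then have "fst y \<le> fst x" by (simp add: s sorted_wrt_append)
    moreover have "fst x \<in> rem_rows l i p" using x removable_box_iff[OF p, of l i "fst x" "snd x"] by simp
    moreover have "fst y \<in> add_rows l i p" using y addable_box_iff[OF p, of l i "fst y" "snd y"] by simp
    ultimately show False using r unfolding reduced_def by (meson not_le)
  qed
  then have "reduction_of (signature l i p) (signature l i p)" by (simp add: reduction_of_def)
  then show ?thesis unfolding reduced_signature_def using reduction_unique by (metis the_equality)
qed

section \<open>Crystal operators when nothing cancels\<close>

lemma fst_last_desc:
  assumes "xs \<noteq> []" "sorted_wrt (\<lambda>x y. fst y \<le> fst x) (xs :: (nat \<times> nat) list)"
  shows "fst (last xs) = Min (fst ` set xs)"
proof -
  obtain ys y where xs: "xs = ys @ [y]" using assms(1) by (metis rev_exhaust)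
  have "\<forall>x\<in>set ys. fst y \<le> fst x" using assms(2) by (simp add: xs sorted_wrt_append)
  then show ?thesis unfolding xs by (intro Min_eqI[symmetric]) auto
qed

lemma fst_hd_desc:
  assumes "xs \<noteq> []" "sorted_wrt (\<lambda>x y. fst y \<le> fst x) (xs :: (nat \<times> nat) list)"
  shows "fst (hd xs) = Max (fst ` set xs)"
proof -
  obtain ys y where xs: "xs = y # ys" using assms(1) by (cases xs) auto
  have "\<forall>x\<in>set ys. fst x \<le> fst y" using assms(2) by (simp add: xs)
  then show ?thesis unfolding xs by (intro Max_eqI[symmetric]) auto
qed

context
  fixes l i :: nat and p :: "nat \<Rightarrow> nat"
  assumes p: "is_partition p" and r: "reduced l i p" and l: "2 \<le> l"
begin

lemma conormal_boxes_eq: "conormal_boxes l i p = filter (\<lambda>x. \<not> removable_box l i p x) (boxes l i p)"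
  by (simp add: conormal_boxes_def reduced_signature_eq[OF p r] signature_boxes filter_map comp_def)

lemma normal_boxes_eq: "normal_boxes l i p = filter (removable_box l i p) (boxes l i p)"
  by (simp add: normal_boxes_def reduced_signature_eq[OF p r] signature_boxes filter_map comp_def)

lemma set_conormal_boxes: "set (conormal_boxes l i p) = (\<lambda>a. (a, p a)) ` add_rows l i p"
  using add_rows_disjoint[OF l, of i p]
  by (auto simp: conormal_boxes_eq set_boxes[OF p] addable_box_iff[OF p] removable_box_iff[OF p])

lemma set_normal_boxes: "set (normal_boxes l i p) = (\<lambda>a. (a, p a - 1)) ` rem_rows l i p"
  by (auto simp: normal_boxes_eq set_boxes[OF p] removable_box_iff[OF p])

lemma phi_eq: "phi l i p = card (add_rows l i p)"
proof -
  have "phi l i p = card (set (conormal_boxes l i p))"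
    unfolding phi_def conormal_boxes_eq by (simp only: distinct_card[OF distinct_filter[OF distinct_boxes]])
  then show ?thesis by (simp add: set_conormal_boxes card_image inj_on_def)
qed

lemma epsilon_eq: "epsilon l i p = card (rem_rows l i p)"
proof -
  have "epsilon l i p = card (set (normal_boxes l i p))"
    unfolding epsilon_def normal_boxes_eq by (simp only: distinct_card[OF distinct_filter[OF distinct_boxes]])
  then show ?thesis by (simp add: set_normal_boxes card_image inj_on_def)
qed

lemma first_row_conormal_eq: "first_row_conormal l i p \<longleftrightarrow> 0 \<in> add_rows l i p"
  by (auto simp: first_row_conormal_def set_conormal_boxes)

text \<open>The rightmost + belongs to the topmost addable row, which has the smallest
  index.\<close>

lemma f_op_eq:
  assumes "add_rows l i p \<noteq> {}"
  shows "f_op l i p = Some (p(Min (add_rows l i p) := p (Min (add_rows l i p)) + 1))"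
proof -
  have ne: "conormal_boxes l i p \<noteq> []" using assms set_conormal_boxes by force
  have "fst (last (conormal_boxes l i p)) = Min (fst ` set (conormal_boxes l i p))"
    using ne by (rule fst_last_desc) (simp add: conormal_boxes_eq sorted_boxes sorted_wrt_filter)
  then show ?thesis using ne by (simp add: f_op_def Let_def set_conormal_boxes image_image)
qed

text \<open>The leftmost - belongs to the lowest removable row, which has the largest index.\<close>

lemma e_op_eq:
  assumes "rem_rows l i p \<noteq> {}"
  shows "e_op l i p = Some (p(Max (rem_rows l i p) := p (Max (rem_rows l i p)) - 1))"
proof -
  have ne: "normal_boxes l i p \<noteq> []" using assms set_normal_boxes by force
  have "fst (hd (normal_boxes l i p)) = Max (fst ` set (normal_boxes l i p))"
    using ne by (rule fst_hd_desc) (simp add: normal_boxes_eq sorted_boxes sorted_wrt_filter)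
  then show ?thesis using ne by (simp add: e_op_def Let_def set_normal_boxes image_image)
qed

end

text \<open>Pair each position x on runner i with x + 1. An addable row is a bead alone on the left
  of its pair, a removable row a bead alone on the right. The pairs are disjoint as
  \<open>2 \<le> l\<close>, so a move inside one pair changes the status of row \<open>a\<close>
  only.\<close>

lemma add_step:
  assumes p: "is_partition p" and l: "2 \<le> l" and a: "a \<in> add_rows l i p"
  defines "q \<equiv> p(a := p a + 1)"
  shows "is_partition q" and "add_rows l i q = add_rows l i p - {a}" and "rem_rows l i q = insert a (rem_rows l i p)"
proof -
  have "a = 0 \<or> p a < p (a - 1)"
    using a bead_plus_gap_iff[OF p, of a] by (auto simp: add_rows_def)
  then show "is_partition q"
    unfolding q_def using partition_le[OF p, of a "Suc a"] by (intro is_partition_upd[OF p]) auto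
  have bq: "bead q = (bead p)(a := bead p a + 1)" by (auto simp: q_def bead_def)
  then have Bq: "beads q = insert (bead p a + 1) (beads p - {bead p a})" by (rule beads_upd[OF p])
  have res: "int l dvd bead p a - int i" and gap: "bead p a + 1 \<notin> beads p"
    using a by (auto simp: add_rows_def)
  have no1: "\<not> int l dvd bead p a + 1 - int i"
  proof
    assume "int l dvd bead p a + 1 - int i"
    from dvd_diff[OF this res] show False using l by simp
  qed
  have "c \<in> add_rows l i q \<longleftrightarrow> c \<in> add_rows l i p - {a}" for c
  proof (cases "c = a")
    case False
    have "bead p c + 1 \<noteq> bead p a + 1" using False by (simp add: bead_eq_iff[OF p])
    moreover have "bead p c + 1 \<noteq> bead p a" if "int l dvd bead p c - int i"
    proof
      assume e: "bead p c + 1 = bead p a"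
      have "int l dvd bead p c + 1 - int i - (bead p c - int i)"
        using dvd_diff[OF res that] by (simp flip: e)
      then show False using l by simp
    qed
    moreover have "bead q c = bead p c" using False bq by simp
    ultimately show ?thesis
      unfolding add_rows_def Bq mem_Collect_eq Diff_iff insert_iff empty_iff using False by metis
  qed (simp add: add_rows_def bq no1)
  then show "add_rows l i q = add_rows l i p - {a}" by blast
  have "c \<in> rem_rows l i q \<longleftrightarrow> c \<in> insert a (rem_rows l i p)" for c
  proof (cases "c = a")
    case True
    then show ?thesis using res Bq by (simp add: rem_rows_def bq)
  next
    case False
    have "bead p c - 1 \<noteq> bead p a" using False gap by (metis diff_add_cancel rangeI)
    moreover have "bead p c - 1 \<noteq> bead p a + 1" if "int l dvd bead p c - 1 - int i"
      using that no1 by metis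
    moreover have "bead q c = bead p c" using False bq by simp
    ultimately show ?thesis
      unfolding rem_rows_def Bq mem_Collect_eq Diff_iff insert_iff empty_iff using False by metis
  qed
  then show "rem_rows l i q = insert a (rem_rows l i p)" by blast
qed

lemma rem_step:
  assumes p: "is_partition p" and a: "a \<in> rem_rows l i p"
  defines "q \<equiv> p(a := p a - 1)"
  shows "is_partition q" and "bead q = (bead p)(a := bead p a - 1)"
proof -
  have "p (Suc a) < p a"
    using a bead_minus_gap_iff[OF p, of a] by (auto simp: rem_rows_def)
  then show "is_partition q"
    unfolding q_def using partition_le[OF p, of "a - 1" a] by (intro is_partition_upd[OF p]) auto
  show "bead q = (bead p)(a := bead p a - 1)"
    using rem_rows_pos[OF p a] by (auto simp: q_def bead_def)
qed

lemma f_power_Suc: "f_op l i p = Some q \<Longrightarrow> f_power l i (Suc n) p = f_power l i n q"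
  by (simp add: f_power_def funpow_Suc_right del: funpow.simps)

text \<open>Each application uses the topmost addable row and turns it into a removable row above
  all remaining addable ones, so the signature stays reduced. The lowest addable row is the one left
  behind.\<close>

lemma f_power_all_but_one:
  assumes "is_partition p" "reduced l i p" "2 \<le> l" "card (add_rows l i p) = Suc n"
  shows "\<exists>q. f_power l i n p = Some q \<and> is_partition q \<and>
    bead q = (\<lambda>a. if a \<in> add_rows l i p - {Max (add_rows l i p)} then bead p a + 1 else bead p a)"
  using assms
proof (induction n arbitrary: p)
  case 0
  then obtain a where "add_rows l i p = {a}" by (metis One_nat_def card_1_singletonE)
  then show ?case using 0 by (simp add: f_power_def)
next
  case (Suc n)
  define A where "A = add_rows l i p"
  have fin: "finite A" "A \<noteq> {}" using Suc.prems finite_add_rows by (auto simp: A_def)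
  define a where "a = Min A"
  have a: "a \<in> A" using fin by (simp add: a_def)
  define p' where "p' = p(a := p a + 1)"
  note step = add_step[OF Suc.prems(1,3) a[unfolded A_def], folded p'_def A_def]
  have f: "f_op l i p = Some p'"
    using f_op_eq[OF Suc.prems(1-3)] fin by (simp add: p'_def a_def A_def)
  have am: "\<forall>b\<in>A - {a}. a < b" using fin by (auto simp: a_def order_le_neq_trans)
  have c: "card (add_rows l i p') = Suc n" using Suc.prems step(2) a fin by (simp add: A_def)
  have red: "reduced l i p'"
    unfolding reduced_def step(2,3) using Suc.prems(2) am by (auto simp: reduced_def A_def)
  obtain q where q: "f_power l i n p' = Some q" "is_partition q"
    "bead q = (\<lambda>b. if b \<in> add_rows l i p' - {Max (add_rows l i p')} then bead p' b + 1 else bead p' b)"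
    using Suc.IH[OF step(1) red Suc.prems(3) c] by blast
  have ne: "A - {a} \<noteq> {}" using c step(2) by force
  have mx: "Max (A - {a}) = Max A"
  proof -
    obtain b where b: "b \<in> A - {a}" using ne by blast
    then have "a < Max A" using am fin by (meson DiffD1 Max_ge less_le_trans)
    moreover have "Max A \<in> A" using fin by simp
    ultimately show ?thesis using fin by (intro Max_eqI) auto
  qed
  have "a < Max A" using ne am fin mx Max_in[of "A - {a}"] by auto
  then have "bead q = (\<lambda>b. if b \<in> A - {Max A} then bead p b + 1 else bead p b)"
    unfolding q(3) step(2) mx using a by (intro ext) (auto simp: p'_def bead_def)
  with q f_power_Suc[OF f, of n] show ?case unfolding A_def by auto
qed

text \<open>If a removable row \<open>b\<close> were below an addable row \<open>a\<close>, the gap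
  \<open>bead p b - 1\<close> would have the bead of \<open>a\<close> above it on its own runner and
  the bead of \<open>b\<close> right next to it.\<close>

lemma gap_cond_reduced:
  assumes p: "is_partition p" and l: "2 \<le> l" and g: "gap_cond l (beads p)"
  shows "reduced l i p"
  unfolding reduced_def
proof (intro ballI, rule ccontr)
  fix a b assume a: "a \<in> add_rows l i p" and b: "b \<in> rem_rows l i p" and n: "\<not> b < a"
  have "a \<noteq> b" using add_rows_disjoint[OF l] a b by blast
  then have lt: "bead p b < bead p a" using n by (simp add: bead_less_iff[OF p])
  have "int l dvd bead p a - int i - (bead p b - 1 - int i)"
    using a b by (intro dvd_diff[of _ "_ - _" "_ - _"]) (auto simp: add_rows_def rem_rows_def)
  then have d: "int l dvd bead p a - (bead p b - 1)" by (simp add: algebra_simps)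
  have "int l dvd bead p b - (bead p b - 1)"
    by (rule gap_condD[OF g _ _ _ _ _ d]) (use b lt in \<open>auto simp: rem_rows_def\<close>)
  then show False using l by simp
qed

subsection \<open>The abacus of a decomposed partition\<close>

lemma dvd_consecutive:
  "2 \<le> l \<Longrightarrow> int l dvd u \<Longrightarrow> int l dvd v \<Longrightarrow> u = v + 1 \<Longrightarrow> False"
  using dvd_diff[of "int l" u v] by simp

text \<open>Having the equation as a premise leaves the linear rearrangement to the
  simplifier.\<close>

lemma dvd_eq_diff: "(d::int) dvd u \<Longrightarrow> d dvd v \<Longrightarrow> w = u - v \<Longrightarrow> d dvd w"
  by simp

lemma dvd_eq_add: "(d::int) dvd u \<Longrightarrow> d dvd v \<Longrightarrow> w = u + v \<Longrightarrow> d dvd w"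
  by simp

lemma obtain_less_Max:
  assumes "card (A :: nat set) > 1"
  obtains a where "a \<in> A" "a < Max A" "Max A \<in> A"
proof -
  have fin: "finite A" using assms by (metis card.infinite not_one_less_zero)
  have "card (A - {Max A}) \<ge> 1" using assms diff_card_le_card_Diff[of "{Max A}" A] by simp
  then have "A - {Max A} \<noteq> {}" by (metis card.empty not_one_le_zero)
  then obtain a where a: "a \<in> A" "a \<noteq> Max A" by blast
  then have "a < Max A" using Max_ge[OF fin] by (simp add: order_le_neq_trans)
  then show ?thesis using that a fin Max_in[OF fin] by blast
qed

text \<open>The abacus of \<open>p \<approx> (\<mu>, r, \<kappa>)\<close>: the first \<open>r + 1\<close> beads lie on the runner of
  \<open>b = \<mu>\<^sub>1 - r\<close> at or above \<open>b\<close>, and the other beads, completed by \<open>b\<close>, form the core \<open>\<mu>\<close>.\<close>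

locale decomposed =
  fixes l r :: nat and p \<kappa> :: "nat \<Rightarrow> nat" and b :: int
  assumes l: "2 \<le> l" and p: "is_partition p" and \<kappa>: "is_partition \<kappa>"
    and top: "j \<le> r \<Longrightarrow> bead p j = b + int l * int (r - j + \<kappa> j)"
    and next_gt: "b - int l < bead p (Suc r)" and next_less: "bead p (Suc r) < b"
    and flush_step: "x \<in> insert b (bead p ` {r<..}) \<Longrightarrow> x - int l \<in> insert b (bead p ` {r<..})"
begin

lemma low: "r < j \<Longrightarrow> bead p j < b"
  using next_less bead_le_iff[OF p, of j "Suc r"] by simp

lemma top_dvd: "j \<le> r \<Longrightarrow> int l dvd bead p j - b"
  by (simp add: top)

lemma top_ge: "j \<le> r \<Longrightarrow> b \<le> bead p j"
  by (simp add: top)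

lemma top_gt: "j < r \<Longrightarrow> b + int l \<le> bead p j"
proof -
  assume "j < r"
  then have "int l * 1 \<le> int l * int (r - j + \<kappa> j)" by (intro mult_left_mono) auto
  then show ?thesis using \<open>j < r\<close> by (simp add: top)
qed

lemma row_top: "bead p j \<ge> b \<Longrightarrow> j \<le> r"
  using low[of j] by linarith

lemma above_dvd: "bead p j \<ge> b \<Longrightarrow> int l dvd bead p j - b"
  using row_top top_dvd by blast

text \<open>Here \<open>b\<close> counts as a bead even when it is vacant, because it completes the
  core. The conclusion names the rows below r, since these beads stay in place when only the top
  rows are moved.\<close>

lemma flush:
  assumes x: "x \<in> beads p \<or> x = b" "x \<le> b" and d: "int l dvd x - g" and g: "g < x"
  shows "g \<in> bead p ` {r<..}"
proof -
  have "x - int l * int n \<in> insert b (bead p ` {r<..})" for n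
  proof (induction n)
    case 0
    have "x \<in> insert b (bead p ` {r<..})"
    proof (cases "x = b")
      case False
      then obtain j where j: "x = bead p j" using x by blast
      then have "r < j" using top_ge[of j] x False by force
      then show ?thesis using j by blast
    qed simp
    then show ?case by simp
  next
    case (Suc n)
    then show ?case using flush_step[OF Suc] by (simp add: algebra_simps)
  qed
  moreover obtain k where k: "x - g = int l * k" using d by blast
  moreover have "0 < int l * k" using k g by simp
  then have "0 \<le> k" by (simp add: zero_less_mult_iff)
  ultimately have "g \<in> insert b (bead p ` {r<..})"
    by (metis diff_diff_eq2 add_diff_cancel_left' nonneg_int_cases)
  then show ?thesis using x g by auto
qed

lemma flush_beads: "x \<in> beads p \<or> x = b \<Longrightarrow> x \<le> b \<Longrightarrow> int l dvd x - g \<Longrightarrow> g < x \<Longrightarrow> g \<in> beads p"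
  using flush by blast

text \<open>This uses the strict bound \<open>next_gt\<close>. Row \<open>Suc r\<close>, close below
  \<open>b\<close> but off its runner, serves as the offending bead whenever a row deeper than r
  takes part in a move.\<close>

lemma next_ndvd: "\<not> int l dvd bead p (Suc r) - b"
  using dvd_diff_eq[of "int l" "bead p (Suc r)" b] next_gt next_less by force

text \<open>By flushness a gap with a bead above it on its runner must lie on the runner of
  \<open>b\<close>, at \<open>b\<close> or higher; all beads above it are then top beads.\<close>

lemma beads_gap_cond: "gap_cond l (beads p)"
  unfolding gap_cond_def
proof (intro allI impI)
  fix g x y assume a: "g \<notin> beads p" "x \<in> beads p" "y \<in> beads p" "g < x" "g < y" "int l dvd x - g"
  have x: "b \<le> x" using flush_beads[of x g] a by force
  then have xb: "int l dvd x - b" using a above_dvd by blast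
  then have gb: "int l dvd b - g" using a(6) by (rule_tac dvd_eq_diff[of _ "x - g" "x - b"]) auto
  then have "b \<le> g" using flush_beads[of b g] a by force
  then have "int l dvd y - b" using a above_dvd by force
  then show "int l dvd y - g" using gb by (rule dvd_eq_add) simp
qed

lemma p_reduced: "reduced l i p"
  by (rule gap_cond_reduced[OF p l beads_gap_cond])

section \<open>Addable and removable rows of a decomposed partition\<close>

lemma zero_add_rows_iff: "0 \<in> add_rows l i p \<longleftrightarrow> int l dvd b - int i"
proof -
  have "bead p 0 + 1 \<noteq> bead p c" for c using bead_le_iff[OF p, of c 0] by linarith
  moreover have "int l dvd bead p 0 - int i \<longleftrightarrow> int l dvd b - int i"
    using dvd_add_right_iff[OF top_dvd[of 0], of "b - int i"] by simp
  ultimately show ?thesis by (auto simp: add_rows_def)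
qed

text \<open>The position after a top bead is above \<open>b\<close> but off the runner of
  \<open>b\<close>, where no beads are.\<close>

lemma top_add_rows:
  assumes "int l dvd b - int i" "j \<le> r"
  shows "j \<in> add_rows l i p"
proof -
  have "bead p j + 1 \<notin> beads p"
  proof
    assume "bead p j + 1 \<in> beads p"
    then obtain c where c: "bead p c = bead p j + 1" by force
    then have "int l dvd bead p j + 1 - b" using above_dvd[of c] top_ge[OF assms(2)] by simp
    then show False using top_dvd[OF assms(2)] by (rule dvd_consecutive[OF l]) simp
  qed
  moreover have "int l dvd bead p j - int i"
    using top_dvd[OF assms(2)] assms(1) by (rule dvd_eq_add) simp
  ultimately show ?thesis by (simp add: add_rows_def)
qed

text \<open>As for addable rows, except that a bead sitting at \<open>b\<close> itself has its lower
  neighbour in the flush region, where it may be occupied.\<close>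

lemma top_rem_rows:
  assumes i: "int l dvd b - 1 - int i" and j: "j \<le> r" and g: "b < bead p j \<or> b - 1 \<notin> beads p"
  shows "j \<in> rem_rows l i p"
proof -
  have "bead p j - 1 \<notin> beads p"
  proof (cases "b < bead p j")
    case True
    show ?thesis
    proof
      assume "bead p j - 1 \<in> beads p"
      then obtain c where c: "bead p c = bead p j - 1" by force
      then have "int l dvd bead p j - 1 - b" using above_dvd[of c] True by simp
      with top_dvd[OF j] show False by (rule dvd_consecutive[OF l]) simp
    qed
  next
    case False
    then show ?thesis using g top_ge[OF j] by simp
  qed
  moreover have "int l dvd bead p j - 1 - int i"
    using top_dvd[OF j] i by (rule dvd_eq_add) simp
  ultimately show ?thesis by (simp add: rem_rows_def)
qed

section \<open>Adding all addable boxes but the lowest\<close>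

lemma add_not_l_partition:
  assumes i: "\<not> int l dvd b - int i" and c: "card (add_rows l i p) > 1" and q: "is_partition q"
    and bq: "bead q = (\<lambda>a. if a \<in> add_rows l i p - {Max (add_rows l i p)} then bead p a + 1 else bead p a)"
  shows "\<not> is_l_partition l q"
proof -
  define A where "A = add_rows l i p"
  define m where "m = Max A"
  obtain a where a: "a \<in> A" "a < m" and m: "m \<in> A"
    using obtain_less_Max[OF c] by (auto simp: A_def m_def)
  have rA: "r < j" if "j \<in> A" for j
  proof (rule ccontr)
    assume "\<not> r < j"
    then have "int l dvd bead p j - b" using top_dvd by simp
    moreover have "int l dvd bead p j - int i" using that by (simp add: A_def add_rows_def)
    ultimately have "int l dvd b - int i"
      by (rule_tac dvd_eq_diff[of _ "bead p j - int i" "bead p j - b"]) auto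
    with i show False by simp
  qed
  \<comment> \<open>If \<open>b\<close> were on runner i + 1, flushness would fill that runner below
    \<open>b\<close>, and only the bead at \<open>b - 1\<close> could be addable; but there are two
    addable rows.\<close>
  have b1: "\<not> int l dvd b - 1 - int i"
  proof
    assume d: "int l dvd b - 1 - int i"
    have "bead p j = b - 1" if j: "j \<in> A" for j
    proof (rule ccontr)
      assume n: "bead p j \<noteq> b - 1"
      have "int l dvd bead p j - int i" using j by (simp add: A_def add_rows_def)
      with d have "int l dvd b - (bead p j + 1)" by (rule dvd_eq_diff) simp
      moreover have "bead p j + 1 < b" using low[OF rA[OF j]] n by simp
      ultimately have "bead p j + 1 \<in> beads p" using flush_beads[of b "bead p j + 1"] by simp
      then show False using j by (simp add: A_def add_rows_def)
    qed
    then have "bead p a = bead p m" using a m by simp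
    then show False using a by (simp add: bead_eq_iff[OF p])
  qed
  \<comment> \<open>The place next to the bead left behind. Row \<open>a\<close> moves onto the
    runner of \<open>g\<close> above it, while row 0 stays on the runner of \<open>b\<close>, a
    different one by \<open>b1\<close>.\<close>
  define g where "g = bead p m + 1"
  have gi: "int l dvd g - 1 - int i" and gp: "g \<notin> beads p"
    using m by (auto simp: g_def A_def add_rows_def)
  have "g \<notin> beads q"
  proof
    assume "g \<in> beads q"
    then obtain c where c: "g = bead q c" by blast
    then have "c \<in> A - {m}" using gp by (auto simp: bq A_def m_def split: if_splits)
    then have "bead p c = bead p m" using c by (simp add: bq A_def m_def g_def)
    then show False using \<open>c \<in> A - {m}\<close> by (simp add: bead_eq_iff[OF p])
  qed
  moreover have "bead q a = bead p a + 1" using a by (simp add: bq A_def m_def)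
  moreover have "g < bead p a + 1" using a bead_less_iff[OF p, of m a] by (simp add: g_def)
  moreover have "int l dvd bead p a + 1 - g"
  proof (rule dvd_eq_diff[of _ "bead p a - int i" "g - 1 - int i"])
    show "int l dvd bead p a - int i" using a by (simp add: A_def add_rows_def)
  qed (use gi in auto)
  moreover have "0 \<notin> A" using rA by blast
  then have "bead q 0 = bead p 0" by (simp add: bq A_def)
  moreover have "g < bead p 0"
  proof -
    have "bead p m < bead p 0" using a by (simp add: bead_less_iff[OF p])
    moreover have "bead p 0 \<noteq> g" using gp by blast
    ultimately show ?thesis by (simp add: g_def)
  qed
  ultimately have "int l dvd bead p 0 - g" if "gap_cond l (beads q)"
    using gap_condD[OF that _ rangeI[of "bead q" a] rangeI[of "bead q" 0], of g] by simp
  moreover have "\<not> int l dvd bead p 0 - g"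
  proof
    assume "int l dvd bead p 0 - g"
    with gi have "int l dvd bead p 0 - 1 - int i" by (rule dvd_eq_add) simp
    from this top_dvd[of 0] have "int l dvd b - 1 - int i" by (rule dvd_eq_diff) auto
    with b1 show False by simp
  qed
  ultimately show ?thesis using l_partition_iff_gap_cond[OF q l] by blast
qed

text \<open>Rows 0 to r are always addable here, so phi = r + 1 means that none deeper is. Row r is
  then the one left behind, and it must sit at \<open>b\<close>.\<close>

lemma add_l_partition_iff:
  assumes i: "int l dvd b - int i" and c: "card (add_rows l i p) > 1" and q: "is_partition q"
    and bq: "bead q = (\<lambda>a. if a \<in> add_rows l i p - {Max (add_rows l i p)} then bead p a + 1 else bead p a)"
  shows "is_l_partition l q \<longleftrightarrow> \<kappa> r = 0 \<and> card (add_rows l i p) = r + 1"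
proof -
  define A where "A = add_rows l i p"
  define m where "m = Max A"
  have fin: "finite A" by (simp add: A_def finite_add_rows[OF p])
  have sub: "{..r} \<subseteq> A" using top_add_rows[OF i] by (auto simp: A_def)
  have AD: "int l dvd bead p j - int i" "bead p j + 1 \<notin> beads p" if "j \<in> A" for j
    using that by (auto simp: A_def add_rows_def)
  have bm: "bead q c = bead p c + 1" if "c \<in> A" "c \<noteq> m" for c
    using that by (simp add: bq A_def m_def)
  have bo: "bead q c = bead p c" if "c \<notin> A \<or> c = m" for c
    using that by (auto simp: bq A_def m_def)
  have cA: "card A = r + 1 \<longleftrightarrow> A = {..r}"
    using card_subset_eq[OF fin sub] by auto
  have "gap_cond l (beads q) \<longleftrightarrow> \<kappa> r = 0 \<and> A = {..r}"
  proof (cases "A = {..r}")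
    case True
    have m: "m = r" unfolding m_def True by (rule Max_eqI) auto
    have r0: "0 < r" using c True by (simp add: A_def[symmetric])
    have qt: "bead q j = bead p j + 1" if "j < r" for j using bm that True m by simp
    have qr: "bead q r = bead p r" using bo m by simp
    have ql: "bead q j = bead p j" if "r < j" for j using bo that True by simp
    show ?thesis
    proof (cases "\<kappa> r = 0")
      case False
      \<comment> \<open>This gap has the moved bead of row 0 above it on its runner, and the unmoved
        bead of row r above it on the runner of \<open>b\<close>.\<close>
      have "b + 1 \<notin> beads q"
      proof
        assume "b + 1 \<in> beads q"
        then obtain j where j: "bead q j = b + 1" by force
        consider "j < r" | "j = r" | "r < j" by linarith
        then show False
        proof cases
          case 1
          then show False using top_gt[of j] qt[of j] j l by simp
        next
          case 2
          then have "int l dvd 1" using top_dvd[of r] j qr by simp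
          then show False using l by simp
        next
          case 3
          then show False using low[of j] ql[of j] j by simp
        qed
      qed
      moreover have "b + 1 < bead q 0" "int l dvd bead q 0 - (b + 1)"
        using qt[OF r0] top_gt[OF r0] top_dvd[of 0] l by auto
      moreover have "b + int l \<le> bead p r"
      proof (rule dvd_diff_ge)
        show "b < bead p r" using False l by (simp add: top)
      qed (simp add: top_dvd)
      then have "b + 1 < bead q r" using l qr by simp
      moreover have "\<not> int l dvd bead q r - (b + 1)"
      proof
        assume "int l dvd bead q r - (b + 1)"
        with top_dvd[of r] show False by (rule dvd_consecutive[OF l]) (simp_all add: qr)
      qed
      ultimately show ?thesis using gap_condD[of l "beads q" "b + 1" "bead q 0" "bead q r"] False
        by blast
    next
      case k0: True
      then have br: "bead p r = b" by (simp add: top)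
      have "gap_cond l (beads q)"
        unfolding gap_cond_def
      proof (intro allI impI)
        fix g x y assume a: "g \<notin> beads q" "x \<in> beads q" "y \<in> beads q" "g < x" "g < y" "int l dvd x - g"
        obtain j where j: "x = bead q j" using a by blast
        obtain k where k: "y = bead q k" using a by blast
        have gl: "g \<notin> bead p ` {r<..}"
        proof
          assume "g \<in> bead p ` {r<..}"
          then obtain c where "r < c" "g = bead p c" by blast
          then have "g = bead q c" using ql by simp
          with a(1) show False by blast
        qed
        show "int l dvd y - g"
        proof (cases "j < r")
          case False
          then have "x = bead p j" "bead p j \<le> b" using j qr ql[of j] br low[of j] by (cases "j = r"; simp)+
          then have "g \<in> bead p ` {r<..}" using flush[of x g] a by blast
          then show ?thesis using gl by blast
        next
          case True
          then have xj: "x = bead p j + 1" using qt j by simp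
          have gb: "int l dvd b + 1 - g"
            by (rule dvd_eq_diff[OF a(6) top_dvd[of j]]) (use True xj in auto)
          show ?thesis
          proof (cases "b \<le> g")
            case True
            have "k < r"
            proof (rule ccontr)
              assume "\<not> k < r"
              then have "y \<le> b" using k qr br ql[of k] low[of k] by (cases "k = r") simp_all
              then show False using True a(5) by simp
            qed
            then have yk: "y = bead p k + 1" using qt k by simp
            show ?thesis
              by (rule dvd_eq_add[OF gb top_dvd[of k]]) (use \<open>k < r\<close> yk in auto)
          next
            case False
            \<comment> \<open>The bead at \<open>b - int l\<close> belongs to a row below r, which
              is not addable, so its right neighbour is occupied. Flushness then fills the runner of
              \<open>b + 1\<close> below \<open>b\<close>, which leaves no room for
              \<open>g\<close>.\<close>
            have "b - int l \<in> bead p ` {r<..}" using flush[of b "b - int l"] l by simp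
            then obtain c where c: "r < c" "bead p c = b - int l" by force
            have "c \<notin> A" using True c \<open>A = {..r}\<close> by simp
            moreover have "int l dvd bead p c - int i"
              using i by (rule dvd_eq_diff[of _ _ "int l"]) (simp_all add: c)
            ultimately have mem: "b - int l + 1 \<in> beads p" using c by (simp add: A_def add_rows_def)
            have d: "int l dvd b - int l + 1 - g"
              by (rule dvd_eq_diff[OF gb, of "int l"]) auto
            have "g + int l \<le> b + 1" using False gb by (intro dvd_diff_ge) auto
            then have "g \<le> b - int l + 1" by simp
            then have "g \<in> bead p ` {r<..}"
            proof (cases "g = b - int l + 1")
              case True
              then obtain c where "g = bead p c" using mem by blast
              moreover from this have "r < c" using top_ge[of c] False by force
              ultimately show ?thesis by blast
            next
              case False
              then show ?thesis using flush[of "b - int l + 1" g] mem d \<open>g \<le> b - int l + 1\<close> l by simp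
            qed
            then show ?thesis using gl by blast
          qed
        qed
      qed
      then show ?thesis using True k0 by simp
    qed
  next
    case False
    then obtain a where "a \<in> A" "a \<notin> {..r}" using sub by blast
    then have a: "a \<in> A" "r < a" by simp_all
    have "m \<in> A" unfolding m_def using a by (intro Max_in[OF fin]) auto
    moreover have "r < m" using a(2) Max_ge[OF fin a(1)] by (simp add: m_def)
    ultimately have m: "m \<in> A" "r < m" by simp_all
    have mb: "bead p m + int l \<le> b"
    proof (rule dvd_diff_ge)
      show "int l dvd b - bead p m" using i AD(1)[OF m(1)] by (rule dvd_eq_diff) simp
      show "bead p m < b" using low m by simp
    qed
    define g where "g = bead p m + 1"
    have gp: "g \<notin> beads p" using AD(2)[OF m(1)] by (simp add: g_def)
    have "g \<notin> beads q"
    proof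
      assume "g \<in> beads q"
      then obtain c where c: "g = bead q c" by blast
      have "c \<in> A \<and> c \<noteq> m"
      proof (rule ccontr)
        assume "\<not> (c \<in> A \<and> c \<noteq> m)"
        then have "g = bead p c" using c bo by blast
        with gp show False by blast
      qed
      then have "c \<in> A" "c \<noteq> m" by blast+
      then have "bead p c = bead p m" using c bm[of c] by (simp add: g_def)
      then show False using \<open>c \<noteq> m\<close> by (simp add: bead_eq_iff[OF p])
    qed
    moreover have q0: "bead q 0 = bead p 0 + 1" using bm[of 0] sub m by auto
    moreover have "g < bead p 0 + 1" using m bead_less_iff[OF p, of m 0] by (simp add: g_def)
    moreover have "0 \<in> A" using sub by auto
    then have "int l dvd bead p 0 + 1 - g"
      by (rule dvd_eq_diff[OF AD(1) AD(1)[OF m(1)]]) (simp add: g_def)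
    \<comment> \<open>Row \<open>Suc r\<close> is off the runner of \<open>b\<close>, so it does not
      move. It lies above \<open>g\<close>, and flushness keeps it off the runner of
      \<open>g\<close>, onto which row 0 has moved.\<close>
    moreover define y where "y = bead p (Suc r)"
    have "Suc r \<notin> A"
    proof
      assume "Suc r \<in> A"
      then have "int l dvd bead p (Suc r) - b"
        using dvd_eq_diff[OF AD(1)[of "Suc r"] i] by simp
      then show False using next_ndvd by simp
    qed
    then have qy: "bead q (Suc r) = y" using bo by (simp add: y_def)
    moreover have gy: "g < y"
    proof -
      have "bead p m < y" using mb next_gt by (simp add: y_def)
      moreover have "y \<noteq> g" using gp y_def by blast
      ultimately show ?thesis by (simp add: g_def)
    qed
    moreover have "\<not> int l dvd y - g"
    proof
      assume "int l dvd y - g"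
      then have "g \<in> beads p" using flush_beads[of y g] gy next_less by (simp add: y_def)
      with gp show False by simp
    qed
    ultimately have "\<not> gap_cond l (beads q)"
      using gap_condD[OF _ _ rangeI[of "bead q" 0] rangeI[of "bead q" "Suc r"], of l g] by auto
    then show ?thesis using False by simp
  qed
  then show ?thesis using l_partition_iff_gap_cond[OF q l] cA by (simp add: A_def)
qed

section \<open>Removing the lowest removable box\<close>

lemma rem_not_l_partition:
  assumes i: "\<not> int l dvd b - 1 - int i" and c: "card (rem_rows l i p) > 1" and q: "is_partition q"
    and m: "m = Max (rem_rows l i p)" and bq: "bead q = (bead p)(m := bead p m - 1)"
  shows "\<not> is_l_partition l q"
proof -
  obtain a where a: "a \<in> rem_rows l i p" "a < m" and mR: "m \<in> rem_rows l i p"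
    using obtain_less_Max[OF c] m by metis
  have res: "int l dvd bead p a - bead p m"
  proof (rule dvd_eq_diff)
    show "int l dvd bead p a - 1 - int i" "int l dvd bead p m - 1 - int i"
      using a mR by (simp_all add: rem_rows_def)
  qed simp
  \<comment> \<open>The vacated place has row \<open>a\<close> above it on its runner i + 1, and row
    0 above it on the runner of \<open>b\<close>, which is another one.\<close>
  have gap: "bead p m \<notin> beads q" using beads_upd[OF p bq] by simp
  have "m \<noteq> 0" using a by simp
  then have b0: "bead q 0 = bead p 0" and ba: "bead q a = bead p a" using bq a by auto
  have "int l dvd bead p 0 - bead p m" if g: "gap_cond l (beads q)"
    using gap_condD[OF g gap rangeI[of "bead q" a] rangeI[of "bead q" 0]] res a \<open>m \<noteq> 0\<close>
    by (simp add: b0 ba bead_less_iff[OF p])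
  moreover have "\<not> int l dvd bead p 0 - bead p m"
  proof
    assume "int l dvd bead p 0 - bead p m"
    moreover have "int l dvd bead p m - 1 - int i" using mR by (simp add: rem_rows_def)
    ultimately have "int l dvd bead p 0 - 1 - int i" by (rule dvd_eq_add) simp
    from this top_dvd[of 0] have "int l dvd b - 1 - int i" by (rule dvd_eq_diff) auto
    with i show False by simp
  qed
  ultimately show ?thesis using l_partition_iff_gap_cond[OF q l] by blast
qed

text \<open>Rows 0 to r - 1 are always removable here, so the lowest removable row \<open>m\<close>
  is r - 1, r or deeper. These cases match epsilon = r, r + 1 and at least r + 2.\<close>

lemma rem_l_partition_iff:
  assumes i: "int l dvd b - 1 - int i" and c: "card (rem_rows l i p) > 1" and q: "is_partition q"
    and m: "m = Max (rem_rows l i p)" and bq: "bead q = (bead p)(m := bead p m - 1)"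
  shows "is_l_partition l q \<longleftrightarrow>
    card (rem_rows l i p) = r \<and> \<kappa> (r - 1) = 0 \<or> card (rem_rows l i p) = r + 1 \<and> \<kappa> r = 0"
proof -
  define R where "R = rem_rows l i p"
  have fin: "finite R" by (simp add: R_def finite_rem_rows[OF p])
  have RD: "int l dvd bead p j - 1 - int i" "bead p j - 1 \<notin> beads p" if "j \<in> R" for j
    using that by (auto simp: R_def rem_rows_def)
  have topR: "j \<in> R" if "j \<le> r" "b < bead p j \<or> b - 1 \<notin> beads p" for j
    using top_rem_rows[OF i that] by (simp add: R_def)
  have sub: "{..<r} \<subseteq> R" using topR top_gt l by force
  have mR: "m \<in> R" using m c fin by (metis Max_in R_def card.empty not_one_less_zero)
  have Rm: "j \<le> m" if "j \<in> R" for j using that m fin by (simp add: R_def)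
  have m0: "0 < m"
  proof -
    obtain a where "a < m" using obtain_less_Max[OF c] m by metis
    then show ?thesis by simp
  qed
  have bo: "bead q c = bead p c" if "c \<noteq> m" for c using that bq by simp
  have bm: "bead q m = bead p m - 1" using bq by simp
  have Bq: "beads q = insert (bead p m - 1) (beads p - {bead p m})" by (rule beads_upd[OF p bq])
  consider (deep) "r < m" | (last) "m = r" | (inner) "m < r" by linarith
  then have "gap_cond l (beads q) \<longleftrightarrow> card R = r \<and> \<kappa> (r - 1) = 0 \<or> card R = r + 1 \<and> \<kappa> r = 0"
  proof cases
    case deep
    have md: "int l dvd b - bead p m"
      using i RD(1)[OF mR] by (rule dvd_eq_diff) simp
    then have mb: "bead p m + int l \<le> b" using low[OF deep] by (rule dvd_diff_ge)
    \<comment> \<open>This makes row r removable even if its bead sits at \<open>b\<close>; together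
      with \<open>m\<close> there are at least r + 2 removable rows.\<close>
    have "b - 1 \<notin> beads p"
    proof
      assume "b - 1 \<in> beads p"
      then have "bead p m - 1 \<in> beads p"
        using flush_beads[of "b - 1" "bead p m - 1"] md low[OF deep] by simp
      with RD(2)[OF mR] show False by simp
    qed
    then have "insert m {..r} \<subseteq> R" using topR mR by auto
    then have "card (insert m {..r}) \<le> card R" by (rule card_mono[OF fin])
    then have cR: "r + 2 \<le> card R" using deep by simp
    have "Suc r \<noteq> m" using md next_ndvd dvd_diff_sym by blast
    then have qn: "bead q (Suc r) = bead p (Suc r)" by (rule bo)
    have q0: "bead q 0 = bead p 0" using bo m0 by simp
    have "int l dvd bead p (Suc r) - bead p m" if g: "gap_cond l (beads q)"
    proof (rule gap_condD[OF g _ rangeI[of "bead q" 0] _ _ _ , of "bead p m"])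
      show "bead p (Suc r) \<in> beads q" using qn by (metis rangeI)
      show "int l dvd bead q 0 - bead p m"
        using dvd_eq_add[OF md top_dvd[of 0]] q0 by simp
      show "bead p m < bead p (Suc r)" using mb next_gt by simp
    qed (use Bq m0 q0 in \<open>auto simp: bead_less_iff[OF p]\<close>)
    moreover have "\<not> int l dvd bead p (Suc r) - bead p m"
    proof
      assume "int l dvd bead p (Suc r) - bead p m"
      from this md have "int l dvd bead p (Suc r) - b" by (rule dvd_eq_diff) simp
      with next_ndvd show False by simp
    qed
    ultimately show ?thesis using cR by auto
  next
    case last
    have "R = {..r}" using sub mR Rm last by (auto simp: le_less)
    then have cR: "card R = r + 1" by simp
    show ?thesis
    proof (cases "\<kappa> r = 0")
      case False
      have gt: "b + int l \<le> bead p r"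
        by (rule dvd_diff_ge) (use False l in \<open>auto simp: top\<close>)
      \<comment> \<open>The gap \<open>b\<close> has row 0 above it on its runner, while the bead of
        row r has just left that runner and is still above \<open>b\<close>.\<close>
      have "b \<notin> beads q"
      proof
        assume "b \<in> beads q"
        then obtain c where c: "b = bead q c" by blast
        show False
        proof (cases "c = r")
          case True
          then have "int l dvd bead p r - b - 0" "bead p r = b + 1" using top_dvd[of r] c bm last by auto
          then show False using l by simp
        next
          case False
          then have "c < r \<or> r < c" by linarith
          then show False using c bo[of c] last False low[of c] top_gt[of c] l by auto
        qed
      qed
      moreover have "int l dvd bead q 0 - b" using bo[of 0] m0 top_dvd[of 0] by simp
      moreover have "b < bead q 0" using bo[of 0] m0 last top_gt[of 0] l by simp
      moreover have "b < bead q m" using bm last gt l by simp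
      moreover have "\<not> int l dvd bead q m - b"
      proof
        assume "int l dvd bead q m - b"
        with top_dvd[of r] show False by (rule dvd_consecutive[OF l]) (use bm last in auto)
      qed
      ultimately have "\<not> gap_cond l (beads q)"
        using gap_condD[of l "beads q" b "bead q 0" "bead q m"] by blast
      then show ?thesis using False cR by simp
    next
      case k0: True
      then have br: "bead p r = b" by (simp add: top)
      have "gap_cond l (beads q)"
        unfolding gap_cond_def
      proof (intro allI impI)
        fix g x y assume a: "g \<notin> beads q" "x \<in> beads q" "y \<in> beads q" "g < x" "g < y" "int l dvd x - g"
        have gl: "g \<notin> bead p ` {r<..}"
        proof
          assume "g \<in> bead p ` {r<..}"
          then obtain c where "r < c" "g = bead p c" by blast
          then have "g = bead q c" using bo last by simp
          with a(1) show False by blast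
        qed
        have y: "y = b - 1 \<or> y \<in> beads p \<and> y \<noteq> b" using a(3) Bq br last by auto
        have x: "x = b - 1 \<or> x \<in> beads p \<and> x \<noteq> b" using a(2) Bq br last by auto
        have gb1: "g \<noteq> b - 1" using a(1) Bq br last by auto
        show "int l dvd y - g"
        proof (cases "b < x")
          case True
          then have "int l dvd x - b" using x above_dvd by auto
          with a(6) have gb: "int l dvd b - g" by (rule dvd_eq_diff) simp
          have "b \<le> g"
          proof (rule ccontr)
            assume "\<not> b \<le> g"
            then have "g \<in> bead p ` {r<..}" using flush[of b g] gb by simp
            with gl show False by simp
          qed
          then have "int l dvd y - b" using y a(5) above_dvd by force
          then show ?thesis using gb by (rule dvd_eq_add) simp
        next
          case False
          have "g \<in> bead p ` {r<..}"
          proof (cases "x = b - 1")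
            case xb: True
            \<comment> \<open>The row of the bead \<open>b - int l\<close> is deeper than the last
              removable row, so \<open>b - int l - 1\<close> is occupied, and flushness fills the
              runner of \<open>b - 1\<close> further down.\<close>
            have "b - int l \<in> bead p ` {r<..}" using flush[of b "b - int l"] l by simp
            then obtain c where c: "r < c" "bead p c = b - int l" by force
            have "c \<notin> R" using c Rm last by force
            moreover have "int l dvd bead p c - 1 - int i"
              using i by (rule dvd_eq_diff[of _ _ "int l"]) (simp_all add: c)
            ultimately have mem: "b - int l - 1 \<in> beads p" using c by (simp add: R_def rem_rows_def)
            have d: "int l dvd b - int l - 1 - g"
              using a(6) by (rule dvd_eq_diff[of _ _ "int l"]) (simp_all add: xb)
            have "g + int l \<le> x" using a by (intro dvd_diff_ge) auto
            then have le: "g \<le> b - int l - 1" using xb by simp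
            show ?thesis
            proof (cases "g = b - int l - 1")
              case True
              then obtain c where "g = bead p c" using mem by blast
              moreover from this have "r < c" using top_ge[of c] True l by force
              ultimately show ?thesis by blast
            next
              case False
              then show ?thesis using flush[of "b - int l - 1" g] mem d le l by simp
            qed
          next
            case False
            then show ?thesis using flush[of x g] x a \<open>\<not> b < x\<close> by auto
          qed
          with gl show ?thesis by simp
        qed
      qed
      then show ?thesis using k0 cR by simp
    qed
  next
    case inner
    have Rr: "R = {..<r}" using sub Rm inner by force
    then have cR: "card R = r" by simp
    have mr: "r = Suc m" using Rm[of "r - 1"] Rr inner by auto
    have "r \<notin> R" using Rr by simp
    \<comment> \<open>Row r is not removable, so both sufficient conditions of
      \<open>top_rem_rows\<close> fail: \<open>b - 1\<close> is occupied, and row r sits at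
      \<open>b\<close>.\<close>
    have b1: "b - 1 \<in> beads p"
    proof (rule ccontr)
      assume "b - 1 \<notin> beads p"
      then have "r \<in> R" by (intro topR[OF order_refl] disjI2)
      with \<open>r \<notin> R\<close> show False by (rule notE)
    qed
    have br: "bead p r = b"
    proof (rule ccontr)
      assume "bead p r \<noteq> b"
      then have "b < bead p r" using top_ge[of r] by simp
      then have "r \<in> R" by (intro topR[OF order_refl] disjI1)
      with \<open>r \<notin> R\<close> show False by (rule notE)
    qed
    have bmm: "bead p m = b + int l * (1 + int (\<kappa> m))" using mr by (simp add: top)
    show ?thesis
    proof (cases "\<kappa> m = 0")
      case False
      have "int l * 1 \<le> int l * int (\<kappa> m)" using False by (intro mult_left_mono) auto
      then have gt: "b + 2 * int l \<le> bead p m" using bmm by (simp add: algebra_simps)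
      have gtall: "b + 2 * int l \<le> bead p c" if "c \<le> m" for c
        using gt bead_le_iff[OF p, of m c] that by simp
      \<comment> \<open>Rows up to \<open>m\<close> start at \<open>b + 2 * int l\<close>, and the
        moved one loses only 1, which is less than \<open>l\<close>; rows from r on are at most
        \<open>b\<close>. The gap is violated by row 0 and the moved bead.\<close>
      have "b + int l \<notin> beads q"
      proof
        assume "b + int l \<in> beads q"
        then obtain c where c: "b + int l = bead q c" by blast
        show False
        proof (cases "c \<le> m")
          case True
          then show False using gtall[of c] bo[of c] bm c l by (cases "c = m") auto
        next
          case False
          then have "bead p c \<le> b" using bead_le_iff[OF p, of c r] br mr by simp
          then show False using c bo[of c] False l by simp
        qed
      qed
      moreover have "int l dvd bead q 0 - (b + int l)" using bo[of 0] m0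
        by (intro dvd_eq_diff[OF top_dvd[OF le0] dvd_refl]) simp
      moreover have "b + int l < bead q 0" using bo[of 0] m0 gtall[of 0] l by simp
      moreover have "b + int l < bead q m" using bm gt l by simp
      moreover have "\<not> int l dvd bead q m - (b + int l)"
      proof
        assume "int l dvd bead q m - (b + int l)"
        then have d: "int l dvd bead p m - b - 1"
          by (rule dvd_eq_add[of _ _ "int l"]) (simp_all add: bm)
        show False by (rule dvd_consecutive[OF l top_dvd[of m] d]) (use inner in auto)
      qed
      ultimately have "\<not> gap_cond l (beads q)"
        using gap_condD[of l "beads q" "b + int l" "bead q 0" "bead q m"] by blast
      then show ?thesis using False cR mr by simp
    next
      case k0: True
      then have bml: "bead p m = b + int l" using bmm by simp
      have "gap_cond l (beads q)"
        unfolding gap_cond_def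
      proof (intro allI impI)
        fix g x y assume a: "g \<notin> beads q" "x \<in> beads q" "y \<in> beads q" "g < x" "g < y" "int l dvd x - g"
        have y: "y = b + int l - 1 \<or> y \<in> beads p \<and> y \<noteq> b + int l" using a(3) Bq bml by auto
        have x: "x = b + int l - 1 \<or> x \<in> beads p \<and> x \<noteq> b + int l" using a(2) Bq bml by auto
        have g: "g \<notin> beads p \<or> g = b + int l" "g \<noteq> b + int l - 1" using a(1) Bq bml by auto
        have gb: "g \<noteq> b" using g br l by auto
        have ge: "b + int l \<le> z" if z: "z \<in> beads p" "b < z" for z
          using z above_dvd by (intro dvd_diff_ge) auto
        show "int l dvd y - g"
        proof (cases "b + int l < x")
          case True
          then have "int l dvd x - b" using x above_dvd l by auto
          with a(6) have gb0: "int l dvd b - g" by (rule dvd_eq_diff) simp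
          have "b < g"
          proof (rule ccontr)
            assume "\<not> b < g"
            then have "g \<in> beads p" using flush_beads[of b g] gb0 gb by simp
            then show False using g \<open>\<not> b < g\<close> l by auto
          qed
          with dvd_diff_sym[OF gb0] have "b + int l \<le> g" by (rule dvd_diff_ge)
          then have "int l dvd y - b" using y a(5) above_dvd l by auto
          then show ?thesis using gb0 by (rule dvd_eq_add) simp
        next
          case False
          have "g \<in> beads p \<and> g < b"
          proof (cases "x = b + int l - 1")
            case xb: True
            have d: "int l dvd b - 1 - g"
              using a(6) by (rule dvd_eq_diff[of _ _ "int l"]) (simp_all add: xb)
            have "g + int l \<le> x" using a by (intro dvd_diff_ge) auto
            then have le: "g \<le> b - 1" using xb by simp
            then show ?thesis using flush_beads[of "b - 1" g] b1 d by (cases "g = b - 1") auto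
          next
            case xb: False
            then have "x \<le> b" using x ge[of x] False by force
            then show ?thesis using flush_beads[of x g] x xb a by auto
          qed
          then show ?thesis using g l by auto
        qed
      qed
      then show ?thesis using k0 cR mr by simp
    qed
  qed
  then show ?thesis using l_partition_iff_gap_cond[OF q l] by (simp add: R_def)
qed

end

text \<open>Going up one row while adding \<open>l - 1\<close> boxes raises the bead by
  \<open>l\<close>; this keeps the r rows stacked on \<open>\<mu>\<close> on the runner of its first
  row. Below them \<open>\<mu>\<close> is shifted down by r rows, hence its beads by r.\<close>

lemma decomposes_decomposed:
  assumes l: "2 \<le> l" and p: "is_partition p" and d: "decomposes l p \<mu> r \<kappa>"
  shows "decomposed l r p \<kappa> (int (\<mu> 0) - int r)"
proof -
  define b where "b = int (\<mu> 0) - int r"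
  have core: "is_core l \<mu>" and ne: "\<mu> 0 - \<mu> 1 \<noteq> l - 1" and \<kappa>: "is_partition \<kappa>"
    and top: "\<And>j. j \<le> r \<Longrightarrow> p j = nu l \<mu> r j + l * \<kappa> j"
    and low: "\<And>j. r < j \<Longrightarrow> p j = nu l \<mu> r j"
    using d by (auto simp: decomposes_def)
  have \<mu>: "is_partition \<mu>" using core by (simp add: is_core_def)
  have flush: "x \<in> beads \<mu> \<Longrightarrow> x - int l \<in> beads \<mu>" for x
    using core_flush[OF core] l by simp
  have low_bead: "bead p j = bead \<mu> (j - r) - int r" if "r < j" for j
    using that by (simp add: bead_def low nu_def)
  have L: "insert b (bead p ` {r<..}) = range (\<lambda>k. bead \<mu> k - int r)"
  proof (intro set_eqI iffI)
    fix x assume x: "x \<in> insert b (bead p ` {r<..})"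
    show "x \<in> range (\<lambda>k. bead \<mu> k - int r)"
    proof (cases "x = b")
      case True
      then have "x = bead \<mu> 0 - int r" by (simp add: b_def bead_def)
      then show ?thesis by blast
    next
      case False
      then obtain j where "r < j" "x = bead p j" using x by blast
      then have "x = bead \<mu> (j - r) - int r" using low_bead by simp
      then show ?thesis by blast
    qed
  next
    fix x assume "x \<in> range (\<lambda>k. bead \<mu> k - int r)"
    then obtain k where k: "x = bead \<mu> k - int r" by blast
    show "x \<in> insert b (bead p ` {r<..})"
    proof (cases "k = 0")
      case True
      then show ?thesis using k by (simp add: b_def bead_def)
    next
      case False
      then have "x = bead p (r + k)" "r + k \<in> {r<..}" using k low_bead[of "r + k"] by simp_all
      then show ?thesis by blast
    qed
  qed
  \<comment> \<open>Flushness puts a bead at \<open>bead \<mu> 0 - int l\<close>, so row 1 is no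
    lower; equality would mean \<open>\<mu> 0 - \<mu> 1 = l - 1\<close>.\<close>
  have next_gt: "bead \<mu> 0 - int l < bead \<mu> 1"
  proof -
    obtain k where k: "bead \<mu> 0 - int l = bead \<mu> k" using flush[of "bead \<mu> 0"] by blast
    then have "k \<noteq> 0" using l by (cases "k = 0") simp_all
    then have "bead \<mu> k \<le> bead \<mu> 1" using bead_le_iff[OF \<mu>] by simp
    moreover have "\<mu> 1 \<le> \<mu> 0" using partition_le[OF \<mu>] by simp
    ultimately show ?thesis using k ne l by (simp add: bead_def)
  qed
  show ?thesis unfolding b_def[symmetric]
  proof
    fix j assume j: "j \<le> r"
    have rj: "int (r - j) = int r - int j" using j by simp
    have "int (nu l \<mu> r j) = int (\<mu> 0) + int (r - j) * (int l - 1)"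
      using j l by (cases "j = r") (auto simp: nu_def of_nat_diff)
    then show "bead p j = b + int l * int (r - j + \<kappa> j)"
      unfolding bead_def top[OF j] b_def of_nat_add of_nat_mult rj by (simp add: algebra_simps)
  next
    show "b - int l < bead p (Suc r)"
      using next_gt low_bead[of "Suc r"] by (simp add: b_def bead_def)
    show "bead p (Suc r) < b"
      using bead_strict[OF \<mu>, of 0 1] low_bead[of "Suc r"] by (simp add: b_def bead_def)
  next
    fix x assume "x \<in> insert b (bead p ` {r<..})"
    then obtain k where k: "x = bead \<mu> k - int r" unfolding L by blast
    obtain k' where "bead \<mu> k - int l = bead \<mu> k'" using flush[of "bead \<mu> k"] by blast
    then have "x - int l = bead \<mu> k' - int r" using k by simp
    then show "x - int l \<in> insert b (bead p ` {r<..})" unfolding L by blast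
  qed (use l p \<kappa> in auto)
qed

theorem theorem2p4p2p4:
  fixes l i r :: nat and p \<mu> \<kappa> :: "nat \<Rightarrow> nat"
  assumes "2 \<le> l" and "i < l"
    and "is_l_partition l p" and "decomposes l p \<mu> r \<kappa>"
  shows "(phi l i p > 1 \<longrightarrow>
            ((\<exists>q. f_power l i (phi l i p - 1) p = Some q \<and> is_l_partition l q) \<longleftrightarrow>
              \<kappa> r = 0 \<and> first_row_conormal l i p \<and> phi l i p = r + 1)) \<and>
         (epsilon l i p > 1 \<longrightarrow>
            ((\<exists>q. e_op l i p = Some q \<and> is_l_partition l q) \<longleftrightarrow>
              first_row_conormal l (i + 1) p \<and>
              ((epsilon l i p = r \<and> \<kappa> (r - 1) = 0) \<or>
               (epsilon l i p = r + 1 \<and> \<kappa> r = 0))))"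
proof -
  have p: "is_partition p" using assms(3) by (simp add: is_l_partition_def)
  define b where "b = int (\<mu> 0) - int r"
  interpret decomposed l r p \<kappa> b
    unfolding b_def by (rule decomposes_decomposed[OF assms(1) p assms(4)])
  note phi = phi_eq[OF p p_reduced l] and eps = epsilon_eq[OF p p_reduced l]
    and first = first_row_conormal_eq[OF p p_reduced l]
  show ?thesis
  proof (intro conjI impI)
    assume c: "phi l i p > 1"
    let ?A = "add_rows l i p"
    have cA: "card ?A = Suc (phi l i p - 1)" "card ?A > 1" using c phi by auto
    obtain q where q: "f_power l i (phi l i p - 1) p = Some q" "is_partition q"
      "bead q = (\<lambda>a. if a \<in> ?A - {Max ?A} then bead p a + 1 else bead p a)"
      using f_power_all_but_one[OF p p_reduced l cA(1)] by blast
    have "is_l_partition l q \<longleftrightarrow> \<kappa> r = 0 \<and> first_row_conormal l i p \<and> phi l i p = r + 1"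
      unfolding first zero_add_rows_iff phi
      using add_l_partition_iff[OF _ cA(2) q(2,3)] add_not_l_partition[OF _ cA(2) q(2,3)] by blast
    then show "(\<exists>q. f_power l i (phi l i p - 1) p = Some q \<and> is_l_partition l q) \<longleftrightarrow>
        \<kappa> r = 0 \<and> first_row_conormal l i p \<and> phi l i p = r + 1"
      using q(1) by simp
  next
    assume c: "epsilon l i p > 1"
    let ?R = "rem_rows l i p"
    have cR: "card ?R > 1" using c eps by simp
    then have ne: "?R \<noteq> {}" by force
    define m where "m = Max ?R"
    have m: "m \<in> ?R" using ne finite_rem_rows[OF p] by (simp add: m_def)
    define q where "q = p(m := p m - 1)"
    note step = rem_step[OF p m, folded q_def]
    have e: "e_op l i p = Some q" using e_op_eq[OF p p_reduced l ne] by (simp add: q_def m_def)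
    \<comment> \<open>A removable i-box belongs to a bead on runner i + 1, so the first row is
      tested for residue i + 1. For i = l - 1 this index is \<open>l\<close>, which the congruence
      reads as 0.\<close>
    have i1: "int l dvd b - int (i + 1) \<longleftrightarrow> int l dvd b - 1 - int i" by (simp add: algebra_simps)
    have "is_l_partition l q \<longleftrightarrow> first_row_conormal l (i + 1) p \<and>
        ((epsilon l i p = r \<and> \<kappa> (r - 1) = 0) \<or> (epsilon l i p = r + 1 \<and> \<kappa> r = 0))"
      unfolding first zero_add_rows_iff eps i1
      using rem_l_partition_iff[OF _ cR step(1) m_def step(2)]
        rem_not_l_partition[OF _ cR step(1) m_def step(2)] by blast
    then show "(\<exists>q. e_op l i p = Some q \<and> is_l_partition l q) \<longleftrightarrow> first_row_conormal l (i + 1) p \<and>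
        ((epsilon l i p = r \<and> \<kappa> (r - 1) = 0) \<or> (epsilon l i p = r + 1 \<and> \<kappa> r = 0))"
      using e by simp
  qed
qed

end
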